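(* Let $d\in\mathbb{N}$ and let $F_1,F_2\in M_d$ be hermitian matrices. Then $$W_{F_1,F_2}\subset\operatorname{conv}\bigl(V^\vee_{\mathbb{R},F_1,F_2}\bigr),$$ where $W_{F_1,F_2}\subset\mathbb{R}^2$ is the convex support of $F_1,F_2$ and $V^\vee_{\mathbb{R},F_1,F_2}\subset\mathbb{R}^2$ is the boundary generating curve of $F_1+\mathrm{i}F_2$.
   Context: $M_d$ denotes the algebra of complex $d\times d$ matrices with the Hilbert-Schmidt inner product $\langle A,B\rangle=\operatorname{tr}(A^*B)$, and $\mathbb{1}\in M_d$ is the identity matrix. Write $A\succeq 0$ if $A$ is positive semi-definite, and let $\mathcal{B}=\{\rho\in M_d : \operatorname{tr}(\rho)=1,\ \rho\succeq 0\}$ be the set of density matrices. For hermitian $F_1,F_2\in M_d$, the convex support (joint algebraic numerical range) is $$W_{F_1,F_2}=\{(\langle F_1,\rho\rangle,\langle F_2,\rho\rangle) : \rho\in\mathcal{B}\}\subset\mathbb{R}^2.$$ (Under the identification $\mathbb{R}^2\cong\mathbb{C}$ this is the numerical range $\{\langle\psi|(F_1+\mathrm{i}F_2)\psi\rangle : \psi\in\mathbb{C}^d,\ \langle\psi|\psi\rangle=1\}$ of $F_1+\mathrm{i}F_2$.) Define the complex projective algebraic curve $$V_{F_1,F_2}=\{(u_0:u_1:u_2)\in\mathbb{P}^2(\mathbb{C}) : \det(u_0\mathbb{1}+u_1F_1+u_2F_2)=0\}.$$ Its projective dual (dual curve) $V^\vee_{F_1,F_2}\subset\mathbb{P}^2(\mathbb{C})^*$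 is the closure of the set of tangent lines to $V_{F_1,F_2}$ at smooth points of $V_{F_1,F_2}$. Here $V_{F_1,F_2}$ is regarded as a (reduced) variety, possibly with several irreducible components, and a point $(x_0:x_1:x_2)\in\mathbb{P}^2(\mathbb{C})^*$ represents the line $\{(u_0:u_1:u_2)\in\mathbb{P}^2(\mathbb{C}) : x_0u_0+x_1u_1+x_2u_2=0\}$. In particular, a component of $V_{F_1,F_2}$ that is a line contributes a single point to the dual. The boundary generating curve is the real affine set $$V^\vee_{\mathbb{R},F_1,F_2}=\{(x_1,x_2)\in\mathbb{R}^2 : (1:x_1:x_2)\in V^\vee_{F_1,F_2}\}.$$ $\operatorname{conv}$ denotes the convex hull in $\mathbb{R}^2$. *)

theory Defs
  imports "HOL-Analysis.Analysis"
begin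

definition mat_adj :: "complex^'m^'n \<Rightarrow> complex^'n^'m" where
  "mat_adj A = (\<chi> i j. cnj (A $ j $ i))"

definition hermitian :: "complex^'d^'d \<Rightarrow> bool" where
  "hermitian A \<longleftrightarrow> mat_adj A = A"

definition pos_semidef :: "complex^'d^'d \<Rightarrow> bool" where
  "pos_semidef A \<longleftrightarrow>
     hermitian A \<and> (\<forall>\<psi>. 0 \<le> Re (\<Sum>i\<in>UNIV. cnj (\<psi> $ i) * (A *v \<psi>) $ i))"

definition hs_inner :: "complex^'d^'d \<Rightarrow> complex^'d^'d \<Rightarrow> complex" where
  "hs_inner A B = trace (mat_adj A ** B)"

definition density_matrices :: "(complex^'d^'d) set" where
  "density_matrices = {\<rho>. trace \<rho> = 1 \<and> pos_semidef \<rho>}"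

text \<open>For hermitian matrices \<open>F\<close> and \<open>\<rho>\<close> the number \<open>hs_inner F \<rho>\<close> is real, so that
  taking real parts below only changes the type.\<close>

definition convex_support :: "complex^'d^'d \<Rightarrow> complex^'d^'d \<Rightarrow> (real \<times> real) set" where
  "convex_support F1 F2 = (\<lambda>\<rho>. (Re (hs_inner F1 \<rho>), Re (hs_inner F2 \<rho>))) ` density_matrices"

text \<open>The complex projective plane. The homogeneous coordinates $u_0, u_1, u_2$ are the components
  \<open>u $ 1\<close>, \<open>u $ 2\<close>, \<open>u $ 3\<close>. The dual plane is represented by the same type: the point with
  coordinates \<open>x\<close> stands for the line \<open>proj_line\<close> with coefficients \<open>x\<close>.\<close>

definition proj_rel :: "complex^3 \<Rightarrow> complex^3 \<Rightarrow> bool" where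
  "proj_rel u v \<longleftrightarrow> u \<noteq> 0 \<and> v \<noteq> 0 \<and> (\<exists>c. v = c *s u)"

lemma part_equivp_proj_rel: "part_equivp proj_rel"
proof (rule part_equivpI)
  have "proj_rel (axis 1 1) (axis 1 1)"
    unfolding proj_rel_def by (auto simp: axis_eq_0_iff intro: exI[of _ 1])
  then show "\<exists>u. proj_rel u u" by blast
  show "symp proj_rel"
  proof (rule sympI)
    fix u v assume "proj_rel u v"
    then obtain c where c: "u \<noteq> 0" "v \<noteq> 0" "v = c *s u"
      unfolding proj_rel_def by blast
    then have "c \<noteq> 0" by auto
    then have "u = inverse c *s v" using c(3) by (simp add: vec_eq_iff)
    then show "proj_rel v u" using c unfolding proj_rel_def by blast
  qed
  show "transp proj_rel"
  proof (rule transpI)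
    fix u v w assume "proj_rel u v" "proj_rel v w"
    then show "proj_rel u w"
      unfolding proj_rel_def by (metis vector_smult_assoc)
  qed
qed

quotient_type cp2 = "complex^3" / partial: proj_rel
  by (rule part_equivp_proj_rel)

text \<open>\<open>proj u\<close> is the point with homogeneous coordinates \<open>u\<close>; it is meaningful only for
  \<open>u \<noteq> 0\<close>, so every use below is guarded accordingly.\<close>

definition proj :: "complex^3 \<Rightarrow> cp2" where
  "proj u = abs_cp2 u"

lemma proj_eq_iff:
  assumes "u \<noteq> 0" "v \<noteq> 0"
  shows "proj u = proj v \<longleftrightarrow> (\<exists>c. v = c *s u)"
proof -
  have "proj_rel u u" "proj_rel v v"
    using assms unfolding proj_rel_def by (auto intro: exI[of _ 1])
  then have "proj u = proj v \<longleftrightarrow> proj_rel u v"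
    unfolding proj_def using Quotient3_rel[OF Quotient3_cp2] by blast
  then show ?thesis using assms by (simp add: proj_rel_def)
qed

lemma proj_cases:
  obtains u where "u \<noteq> 0" "p = proj u"
proof -
  have "proj_rel (rep_cp2 p) (rep_cp2 p)" "p = proj (rep_cp2 p)"
    unfolding proj_def
    using Quotient3_rep_reflp[OF Quotient3_cp2] Quotient3_abs_rep[OF Quotient3_cp2] by metis+
  then show ?thesis using that unfolding proj_rel_def by blast
qed

definition proj_line :: "cp2 \<Rightarrow> cp2 set" where
  "proj_line q = {proj u | u x. u \<noteq> 0 \<and> x \<noteq> 0 \<and> q = proj x \<and> (\<Sum>i\<in>UNIV. x $ i * u $ i) = 0}"

text \<open>Homogeneous polynomials of degree \<open>n\<close> in three variables, as functions; nothing is lost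
  because the field is infinite.\<close>

definition hom_poly :: "nat \<Rightarrow> (complex^3 \<Rightarrow> complex) \<Rightarrow> bool" where
  "hom_poly n f \<longleftrightarrow>
     (\<exists>c. \<forall>u. f u = (\<Sum>i\<le>n. \<Sum>j\<le>n - i. c i j * u $ 1 ^ i * u $ 2 ^ j * u $ 3 ^ (n - i - j)))"

text \<open>The homogeneous elements of the (radical) vanishing ideal of \<open>S\<close>. Working with this ideal,
  rather than with a given equation of \<open>S\<close>, is what makes tangent spaces and smoothness refer to
  the reduced variety.\<close>

definition vanishing_forms :: "cp2 set \<Rightarrow> (complex^3 \<Rightarrow> complex) set" where
  "vanishing_forms S =
     {f. (\<exists>n. hom_poly n f) \<and> (\<forall>u. u \<noteq> 0 \<longrightarrow> proj u \<in> S \<longrightarrow> f u = 0)}"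

definition zariski_closure :: "cp2 set \<Rightarrow> cp2 set" where
  "zariski_closure S = {proj u | u. u \<noteq> 0 \<and> (\<forall>f\<in>vanishing_forms S. f u = 0)}"

definition grad :: "(complex^3 \<Rightarrow> complex) \<Rightarrow> complex^3 \<Rightarrow> complex^3" where
  "grad f u = (\<chi> i. deriv (\<lambda>t. f (u + axis i t)) 0)"

text \<open>Jacobian criterion for a plane curve \<open>S\<close>: since all components have codimension one,
  \<open>S\<close> is smooth at a point iff the gradients of its vanishing forms span a space of dimension one
  there. The dimension is never larger than one on a curve.\<close>

definition smooth_point :: "cp2 set \<Rightarrow> cp2 \<Rightarrow> bool" where
  "smooth_point S p \<longleftrightarrow>
     p \<in> S \<and> (\<exists>u f. u \<noteq> 0 \<and> p = proj u \<and> f \<in> vanishing_forms S \<and> grad f u \<noteq> 0)"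

definition tangent_space :: "cp2 set \<Rightarrow> cp2 \<Rightarrow> cp2 set" where
  "tangent_space S p =
     {proj v | v u. v \<noteq> 0 \<and> u \<noteq> 0 \<and> p = proj u \<and>
        (\<forall>f\<in>vanishing_forms S. (\<Sum>i\<in>UNIV. grad f u $ i * v $ i) = 0)}"

definition dual_curve :: "cp2 set \<Rightarrow> cp2 set" where
  "dual_curve S =
     zariski_closure {q. \<exists>p. smooth_point S p \<and> tangent_space S p = proj_line q}"

definition det_curve :: "complex^'d^'d \<Rightarrow> complex^'d^'d \<Rightarrow> cp2 set" where
  "det_curve F1 F2 =
     {proj u | u. u \<noteq> 0 \<and>
        det (\<chi> i j. u $ 1 * mat 1 $ i $ j + u $ 2 * F1 $ i $ j + u $ 3 * F2 $ i $ j) = 0}"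

definition boundary_generating_curve ::
    "complex^'d^'d \<Rightarrow> complex^'d^'d \<Rightarrow> (real \<times> real) set" where
  "boundary_generating_curve F1 F2 =
     {(x1, x2). proj (vector [1, of_real x1, of_real x2]) \<in> dual_curve (det_curve F1 F2)}"

end

theory Submission
  imports Defs "HOL-Computational_Algebra.Polynomial"
begin

text \<open>
  Let \<open>\<mu> s\<close> be the extreme eigenvalue of the pencil \<open>F + s G\<close>, so that \<open>(- \<mu> s : 1 : s)\<close> runs through the
  curve \<open>det_curve F G\<close>. The minimal polynomial \<open>P\<close> of the pencil over the rational functions in \<open>s\<close>,
  homogenised, vanishes on the curve; for all but finitely many real \<open>s\<close> it specialises to the minimal
  polynomial of a hermitian matrix and therefore has simple roots. Hence the curve is smooth at
  \<open>(- \<mu> s : 1 : s)\<close>, and, \<open>\<mu>\<close> being Lipschitz, \<open>\<mu>\<close> is differentiable at \<open>s\<close>. Every vanishing form has a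
  gradient orthogonal to the point and to the velocity \<open>(- \<mu>' s, 0, 1)\<close>, so the tangent line is
  \<open>(1 : \<mu> s - s \<mu>' s : \<mu>' s)\<close>, and comparing \<open>\<mu>\<close> with the quadratic form at a top eigenvector shows that
  this is the point of the numerical range supporting the direction \<open>(1, s)\<close>. The boundary generating
  curve is closed and so contains a compact part of the numerical range which supports the convex
  support in a dense set of directions; separation of convex sets does the rest.
\<close>

section \<open>The minimal polynomial of a hermitian pencil\<close>

text \<open>Fraction-free Gaussian elimination.\<close>

lemma polynomial_vectors_dependent_or_generically_independent:
  fixes v :: "nat \<Rightarrow> 'i \<Rightarrow> 'a::field poly"
  assumes "finite X"
  shows "(\<exists>c. (\<exists>i<k. c i \<noteq> 0) \<and> (\<forall>x\<in>X. (\<Sum>i<k. c i * v i x) = 0)) \<or>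
    k \<le> card X \<and> (\<exists>D. D \<noteq> 0 \<and> (\<forall>z a. poly D z \<noteq> 0 \<longrightarrow>
      (\<forall>x\<in>X. (\<Sum>i<k. a i * poly (v i x) z) = 0) \<longrightarrow> (\<forall>i<k. a i = 0)))"
  using assms
proof (induction k arbitrary: v X)
  case 0
  show ?case by (auto intro!: exI[of _ 1])
next
  case (Suc k)
  show ?case
  proof (cases "\<forall>x\<in>X. v 0 x = 0")
    case True
    have "(\<Sum>i<Suc k. (if i = 0 then 1 else 0) * v i x) = 0" if "x \<in> X" for x
      using True that by (subst sum.lessThan_Suc_shift) simp
    then show ?thesis by (intro disjI1 exI[of _ "\<lambda>i. if i = 0 then 1 else 0"]) auto
  next
    case False
    then obtain p where p: "p \<in> X" "v 0 p \<noteq> 0" by blast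
    \<comment> \<open>Elimination with the pivot \<open>v 0 p\<close>: cross-multiplying avoids
      division, and every \<open>w i\<close> vanishes at \<open>p\<close>, so the induction
      continues on \<open>X - {p}\<close>.\<close>
    define w where "w i x = v 0 p * v (Suc i) x - v (Suc i) p * v 0 x" for i x
    from Suc.IH[OF finite_Diff[OF Suc.prems], of "{p}" w] show ?thesis
    proof (elim disjE exE conjE)
      fix c j
      assume dep: "j < k" "c j \<noteq> 0" and zero: "\<forall>x\<in>X - {p}. (\<Sum>i<k. c i * w i x) = 0"
      \<comment> \<open>Undoes the elimination: the coefficients are multiplied by the pivot, and
        that of \<open>v 0\<close> collects the subtracted terms.\<close>
      define c' where "c' i = (case i of 0 \<Rightarrow> - (\<Sum>i<k. c i * v (Suc i) p) | Suc i \<Rightarrow> c i * v 0 p)" for i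
      have "(\<Sum>i<Suc k. c' i * v i x) = (\<Sum>i<k. c i * w i x)" for x
        by (subst sum.lessThan_Suc_shift)
          (simp add: c'_def w_def algebra_simps sum_subtractf sum_distrib_right sum_distrib_left)
      moreover have "(\<Sum>i<k. c i * w i x) = 0" if "x \<in> X" for x
      proof (cases "x = p")
        case True
        then show ?thesis by (simp add: w_def mult.commute)
      qed (use zero that in simp)
      ultimately have "\<forall>x\<in>X. (\<Sum>i<Suc k. c' i * v i x) = 0" by simp
      moreover have "c' (Suc j) \<noteq> 0" using dep p by (simp add: c'_def)
      moreover have "Suc j < Suc k" using dep(1) by simp
      ultimately show ?thesis by blast
    next
      fix D
      assume D: "D \<noteq> 0" and card: "k \<le> card (X - {p})"
        and ind: "\<forall>z a. poly D z \<noteq> 0 \<longrightarrow> (\<forall>x\<in>X - {p}. (\<Sum>i<k. a i * poly (w i x) z) = 0) \<longrightarrow>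
          (\<forall>i<k. a i = 0)"
      have "Suc k \<le> card X"
        using card p Suc.prems by (metis Suc_le_mono card_Suc_Diff1)
      \<comment> \<open>The zeros of the pivot are excluded along with those of \<open>D\<close>:
        the induction hypothesis kills the later coefficients, and the coordinate \<open>p\<close>
        then kills \<open>a 0\<close>.\<close>
      moreover have "\<forall>i<Suc k. a i = 0"
        if z: "poly (D * v 0 p) z \<noteq> 0"
          and a: "\<forall>x\<in>X. (\<Sum>i<Suc k. a i * poly (v i x) z) = 0" for z a
      proof -
        have a': "(\<Sum>i<k. a (Suc i) * poly (v (Suc i) x) z) = - a 0 * poly (v 0 x) z" if "x \<in> X" for x
          using a that by (subst (asm) sum.lessThan_Suc_shift) (simp add: eq_neg_iff_add_eq_0 add.commute)
        have "(\<Sum>i<k. a (Suc i) * poly (w i x) z) = 0" if "x \<in> X" for x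
        proof -
          have "(\<Sum>i<k. a (Suc i) * poly (w i x) z) =
            poly (v 0 p) z * (\<Sum>i<k. a (Suc i) * poly (v (Suc i) x) z) -
            poly (v 0 x) z * (\<Sum>i<k. a (Suc i) * poly (v (Suc i) p) z)"
            by (simp add: w_def algebra_simps sum_subtractf sum_distrib_right sum_distrib_left)
          then show ?thesis using a'[OF that] a'[OF p(1)] by simp
        qed
        then have *: "\<forall>i<k. a (Suc i) = 0" using ind[rule_format, of z "\<lambda>i. a (Suc i)"] z by simp
        then have "a 0 * poly (v 0 p) z = 0" using a'[OF p(1)] by simp
        then have "a 0 = 0" using z by simp
        with * show ?thesis by (metis less_Suc_eq_0_disj)
      qed
      moreover have "D * v 0 p \<noteq> 0" using D p(2) by simp
      ultimately show ?thesis by blast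
    qed
  qed
qed

section \<open>Evaluation of polynomials at square matrices\<close>

definition mat_poly :: "'a::comm_ring_1 poly \<Rightarrow> 'a^'n^'n \<Rightarrow> 'a^'n^'n" where
  "mat_poly p A = fold_coeffs (\<lambda>c X. mat c + A ** X) p 0"

lemma mat_0: "mat 0 = (0 :: 'a::zero^'n^'n)"
  by (simp add: mat_def vec_eq_iff)

lemma mat_poly_0 [simp]: "mat_poly 0 A = 0"
  by (simp add: mat_poly_def)

lemma mat_poly_pCons [simp]: "mat_poly (pCons c p) A = mat c + A ** mat_poly p A"
  by (cases "p = 0 \<and> c = 0") (auto simp: mat_poly_def mat_0 fold_coeffs_pCons_eq)

lemma mat_mul_nth: "(mat c ** A) $ i $ j = c * A $ i $ j" for A :: "'a::comm_semiring_1^'m^'n"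
  by (simp add: matrix_matrix_mult_def mat_def if_distrib[where f="\<lambda>x. x * _"] cong: if_cong)

lemma mul_mat_nth: "(A ** mat c) $ i $ j = c * A $ i $ j" for A :: "'a::comm_semiring_1^'m^'n"
  by (simp add: matrix_matrix_mult_def mat_def if_distrib[where f="\<lambda>x. _ * x"] mult.commute cong: if_cong)

lemma mat_mult_commute: "mat c ** A = A ** mat c" for A :: "'a::comm_semiring_1^'n^'n"
  by (simp add: vec_eq_iff mat_mul_nth mul_mat_nth)

lemma mat_mult_vec: "mat c *v x = c *s x" for x :: "'a::comm_semiring_1^'n"
  by (simp add: vec_eq_iff matrix_vector_mult_def mat_def if_distrib[where f="\<lambda>x. x * _"] cong: if_cong)

lemma mat_poly_add: "mat_poly (p + q) A = mat_poly p A + mat_poly q A" for A :: "'a::comm_ring_1^'n^'n"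
proof (induction p q rule: poly_induct2)
  case (pCons a p b q)
  have "mat (a + b) = mat a + (mat b :: 'a^'n^'n)" by (simp add: mat_def vec_eq_iff)
  then show ?case using pCons by (simp add: matrix_add_ldistrib algebra_simps)
qed simp

lemma mat_poly_smult: "mat_poly (smult c p) A = mat c ** mat_poly p A" for A :: "'a::comm_ring_1^'n^'n"
proof (induction p)
  case (pCons a p)
  have "mat (c * a) = mat c ** (mat a :: 'a^'n^'n)"
    by (simp add: vec_eq_iff mat_mul_nth) (simp add: mat_def)
  moreover have "A ** (mat c ** X) = mat c ** (A ** X)" for X :: "'a^'n^'n"
    unfolding matrix_mul_assoc mat_mult_commute[of c A] ..
  ultimately show ?case using pCons by (simp add: matrix_add_ldistrib)
qed (simp add: vec_eq_iff mat_mul_nth)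

text \<open>The case of multiplicativity of evaluation that is used to split off a root.\<close>

lemma mat_poly_linear_factor:
  fixes A :: "'a::comm_ring_1^'n^'n"
  shows "mat_poly ([:- c, 1:] * q) A = (A - mat c) ** mat_poly q A"
proof -
  have "[:- c, 1:] * q = pCons 0 q + smult (- c) q" by simp
  moreover have "(A - mat c) ** X = A ** X + mat (- c) ** X" for X :: "'a^'n^'n"
    by (simp add: vec_eq_iff mat_mul_nth)
      (simp add: matrix_matrix_mult_def mat_def left_diff_distrib sum_subtractf
        if_distrib[where f="\<lambda>x. x * _"] cong: if_cong)
  ultimately show ?thesis
    by (simp only: mat_poly_add mat_poly_smult mat_poly_pCons mat_0 add_0)
qed

text \<open>Turns annihilation of \<open>A\<close> by a polynomial into a linear relation between
  the powers of \<open>A\<close>, read as families of entries. The bound \<open>k\<close> is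
  arbitrary above the degree, so the number of summands can be fixed in advance.\<close>

lemma mat_poly_nth:
  assumes "degree p < k"
  shows "mat_poly p A $ a $ b = (\<Sum>i<k. coeff p i * mat_poly (monom 1 i) A $ a $ b)"
  using assms
proof (induction p arbitrary: k a b)
  case 0
  then show ?case by simp
next
  case (pCons c p)
  obtain k' where k: "k = Suc k'" using pCons.prems by (cases k) auto
  have "mat_poly p A $ d $ b = (\<Sum>i<k'. coeff p i * mat_poly (monom 1 i) A $ d $ b)" for d
  proof (cases "p = 0")
    case False
    then show ?thesis using pCons.prems k by (intro pCons.IH) simp
  qed simp
  then have "mat_poly (pCons c p) A $ a $ b =
     mat c $ a $ b + (\<Sum>d\<in>UNIV. A $ a $ d * (\<Sum>i<k'. coeff p i * mat_poly (monom 1 i) A $ d $ b))"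
    by (simp add: matrix_matrix_mult_def)
  also have "(\<Sum>d\<in>UNIV. A $ a $ d * (\<Sum>i<k'. coeff p i * mat_poly (monom 1 i) A $ d $ b)) =
     (\<Sum>i<k'. coeff p i * (A ** mat_poly (monom 1 i) A) $ a $ b)"
    by (simp add: matrix_matrix_mult_def sum_distrib_left)
      (subst sum.swap, simp add: mult_ac)
  finally show ?case unfolding k
    by (subst sum.lessThan_Suc_shift) (simp add: monom_Suc mat_0 monom_0 mat_def)
qed

lemma mat_poly_eigenvector:
  fixes A :: "'a::field^'n^'n"
  assumes "A *v x = l *s x"
  shows "mat_poly p A *v x = poly p l *s x"
proof (induction p)
  case (pCons c p)
  have "(A ** mat_poly p A) *v x = (poly p l * l) *s x"
    by (metis assms pCons.IH matrix_vector_mul_assoc vector_scalar_commute vector_smult_assoc)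
  then show ?case
    by (simp add: mat_mult_vec matrix_vector_mult_add_rdistrib vector_sadd_rdistrib mult.commute[of l])
qed simp

section \<open>Hermitian matrices and simple roots\<close>

lemma hermitian_nth: "hermitian A \<Longrightarrow> cnj (A $ i $ j) = A $ j $ i"
  by (simp add: hermitian_def mat_adj_def vec_eq_iff)

lemma inner_vec_complex: "x \<bullet> y = Re (\<Sum>i\<in>UNIV. cnj (x $ i) * y $ i)" for x y :: "complex^'n"
  by (simp add: inner_vec_def inner_complex_def)

lemma hermitian_inner:
  assumes "hermitian A"
  shows "(A *v x) \<bullet> y = x \<bullet> (A *v y)"
proof -
  have "(A *v x) \<bullet> y = Re (\<Sum>i\<in>UNIV. \<Sum>j\<in>UNIV. cnj (A $ i $ j) * cnj (x $ j) * y $ i)"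
    by (simp only: inner_vec_complex matrix_vector_mult_def vec_lambda_beta cnj_sum
       sum_distrib_right complex_cnj_mult)
  also have "\<dots> = Re (\<Sum>j\<in>UNIV. \<Sum>i\<in>UNIV. cnj (A $ i $ j) * cnj (x $ j) * y $ i)"
    by (subst sum.swap) simp
  also have "\<dots> = x \<bullet> (A *v y)"
    by (simp only: inner_vec_complex matrix_vector_mult_def vec_lambda_beta hermitian_nth[OF assms]
       sum_distrib_left mult_ac)
  finally show ?thesis .
qed

text \<open>\<open>A\<close> moves across the inner product, so the squared norm of
  \<open>(A ** B) *v x\<close> is the inner product of \<open>B *v x\<close> with
  \<open>(A ** (A ** B)) *v x\<close>.\<close>

lemma hermitian_square_mult_eq_0:
  assumes "hermitian A" "A ** (A ** B) = 0"
  shows "A ** B = 0"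
proof -
  have "(A ** B) *v x = 0" for x
  proof -
    have "((A ** B) *v x) \<bullet> ((A ** B) *v x) = (B *v x) \<bullet> ((A ** (A ** B)) *v x)"
      using hermitian_inner[OF assms(1), of "B *v x" "(A ** B) *v x"]
      by (simp add: matrix_vector_mul_assoc)
    then show ?thesis using assms(2) by simp
  qed
  then show ?thesis by (simp add: matrix_eq)
qed

lemma hermitian_minus_mat: "hermitian A \<Longrightarrow> hermitian (A - mat (of_real l))"
  by (simp add: hermitian_def mat_adj_def vec_eq_iff mat_def)

text \<open>Hermitian matrices are diagonalisable, so their minimal polynomials have simple roots.\<close>

lemma hermitian_min_poly_simple_root:
  fixes p :: "complex poly" and l :: real
  assumes A: "hermitian A" and p: "mat_poly p A = 0" "p \<noteq> 0"
    and minimal: "\<And>q. mat_poly q A = 0 \<Longrightarrow> degree q < degree p \<Longrightarrow> q = 0"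
    and x: "A *v x = of_real l *s x" "x \<noteq> 0"
  shows "poly p (of_real l) = 0" "poly (pderiv p) (of_real l) \<noteq> 0"
proof -
  have "poly p (of_real l) *s x = 0"
    using mat_poly_eigenvector[OF x(1), of p] p(1) by simp
  then show root: "poly p (of_real l) = 0" using x(2) by (auto simp: vec_eq_iff)
  show "poly (pderiv p) (of_real l) \<noteq> 0"
  proof
    assume double: "poly (pderiv p) (of_real l) = 0"
    obtain q where q: "p = [:- of_real l, 1:] * q"
      using root by (metis poly_eq_0_iff_dvd dvdE)
    have "pderiv p = [:- of_real l, 1:] * pderiv q + q"
      unfolding q by (subst pderiv_mult) (simp add: pderiv_pCons)
    then have "poly q (of_real l) = 0" using double by simp
    then obtain r where r: "q = [:- of_real l, 1:] * r"
      by (metis poly_eq_0_iff_dvd dvdE)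
    have "mat_poly q A = 0"
      using p(1) hermitian_square_mult_eq_0[OF hermitian_minus_mat[OF A]]
      unfolding q r mat_poly_linear_factor by blast
    moreover have "degree p = degree q + 1"
      using p(2) unfolding q by (subst degree_mult_eq) auto
    ultimately have "q = 0" by (intro minimal) auto
    then show False using q p(2) by simp
  qed
qed

lemma mat_poly_monom_Suc: "mat_poly (monom c (Suc i)) A = A ** mat_poly (monom c i) A"
  by (simp add: monom_Suc mat_0)

lemma polynomial_entries_mat_poly_monom:
  fixes F G :: "complex^'n^'n"
  shows "\<exists>q. \<forall>z. mat_poly (monom 1 i) (F + mat z ** G) $ a $ b = poly q z"
proof (induction i arbitrary: a)
  case 0
  show ?case
    by (rule exI[of _ "[:mat 1 $ a $ b:]"]) (simp add: monom_0)
next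
  case (Suc i)
  then obtain q where q: "\<And>c z. mat_poly (monom 1 i) (F + mat z ** G) $ c $ b = poly (q c) z"
    by metis
  have "mat_poly (monom 1 (Suc i)) (F + mat z ** G) $ a $ b =
     poly (\<Sum>c\<in>UNIV. [:F $ a $ c, G $ a $ c:] * q c) z" for z
    by (simp add: mat_poly_monom_Suc matrix_matrix_mult_def[of "F + _"] mat_mul_nth q poly_sum algebra_simps)
  then show ?case by blast
qed

text \<open>The coefficients \<open>c i\<close> are those of the minimal polynomial of the pencil over the field of rational
  functions, with denominators cleared.\<close>

lemma pencil_min_poly:
  fixes F G :: "complex^'n^'n"
  obtains k and c :: "nat \<Rightarrow> complex poly" and D :: "complex poly"
  where "\<And>z. mat_poly (\<Sum>i\<le>k. monom (poly (c i) z) i) (F + mat z ** G) = 0"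
    and "D \<noteq> 0"
    and "\<And>z. poly D z \<noteq> 0 \<Longrightarrow> poly (c k) z \<noteq> 0"
    and "\<And>z q. poly D z \<noteq> 0 \<Longrightarrow> mat_poly q (F + mat z ** G) = 0 \<Longrightarrow> degree q < k \<Longrightarrow> q = 0"
proof -
  have "\<forall>i x. \<exists>q. \<forall>z. mat_poly (monom 1 i) (F + mat z ** G) $ (fst x) $ (snd x) = poly q z"
    using polynomial_entries_mat_poly_monom by blast
  then obtain v :: "nat \<Rightarrow> 'n \<times> 'n \<Rightarrow> complex poly" where
    v: "\<And>i a b z. mat_poly (monom 1 i) (F + mat z ** G) $ a $ b = poly (v i (a, b)) z"
    by (metis fst_conv snd_conv)
  \<comment> \<open>\<open>dep k\<close>: the powers of the pencil with exponents below
    \<open>k\<close> are linearly dependent over the polynomials in \<open>z\<close>. The degree of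
    the minimal polynomial is one less than the least such number.\<close>
  define dep where "dep k \<longleftrightarrow> (\<exists>c. (\<exists>i<k. c i \<noteq> 0) \<and> (\<forall>x\<in>UNIV. (\<Sum>i<k. c i * v i x) = 0))" for k
  have dich: "dep k \<or> k \<le> CARD('n \<times> 'n) \<and> (\<exists>D. D \<noteq> 0 \<and> (\<forall>z a. poly D z \<noteq> 0 \<longrightarrow>
      (\<forall>x\<in>UNIV. (\<Sum>i<k. a i * poly (v i x) z) = 0) \<longrightarrow> (\<forall>i<k. a i = 0)))" for k
    unfolding dep_def by (rule polynomial_vectors_dependent_or_generically_independent[OF finite])
  \<comment> \<open>There are \<open>CARD('n \<times> 'n)\<close> entries, so one more power than
    that is dependent.\<close>
  have "\<exists>k. dep k" using dich[of "Suc (CARD('n \<times> 'n))"] Suc_n_not_le_n by blast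
  define m where "m = (LEAST k. dep k)"
  have m: "dep m" "\<And>k. k < m \<Longrightarrow> \<not> dep k"
    using \<open>\<exists>k. dep k\<close> unfolding m_def by (auto intro: LeastI dest: not_less_Least)
  then have "m \<noteq> 0" by (auto simp: dep_def)
  then obtain k where k: "m = Suc k" by (cases m) auto
  obtain c where c: "\<exists>i<Suc k. c i \<noteq> 0" "\<And>x. (\<Sum>i<Suc k. c i * v i x) = 0"
    using m(1) unfolding k dep_def by blast
  have "c k \<noteq> 0"
  proof
    assume "c k = 0"
    then have "\<exists>i<k. c i \<noteq> 0" "\<And>x. (\<Sum>i<k. c i * v i x) = 0"
      using c less_Suc_eq by (auto)
    then have "dep k" unfolding dep_def by blast
    then show False using m(2)[of k] k by simp
  qed
  have "\<not> dep k" using m(2) k by simp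
  with dich[of k] obtain D where D: "D \<noteq> 0" "\<forall>z a. poly D z \<noteq> 0 \<longrightarrow>
      (\<forall>x\<in>UNIV. (\<Sum>i<k. a i * poly (v i x) z) = 0) \<longrightarrow> (\<forall>i<k. a i = 0)"
    by blast
  show ?thesis
  \<comment> \<open>Off the zeros of the chosen polynomial the first \<open>k\<close> powers remain
    independent (factor \<open>D\<close>) and the leading coefficient does not vanish (factor
    \<open>c k\<close>).\<close>
  proof (rule that[where k = k and c = c and D = "D * c k"])
    fix z
    define p where "p = (\<Sum>i\<le>k. monom (poly (c i) z) i)"
    have "degree p < Suc k"
      unfolding p_def by (auto simp: less_Suc_eq_le intro!: degree_sum_le order.trans[OF degree_monom_le])
    then have "mat_poly p (F + mat z ** G) $ a $ b = (\<Sum>i<Suc k. coeff p i * poly (v i (a, b)) z)" for a b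
      by (simp only: mat_poly_nth v)
    also have "\<dots> a b = (\<Sum>i<Suc k. poly (c i) z * poly (v i (a, b)) z)" for a b
      by (intro sum.cong) (auto simp: p_def coeff_sum if_distrib[where f="\<lambda>x. x * _"])
    also have "\<dots> a b = poly (\<Sum>i<Suc k. c i * v i (a, b)) z" for a b
      by (simp only: poly_sum poly_mult)
    also have "\<dots> a b = 0" for a b by (simp only: c(2) poly_0)
    finally show "mat_poly (\<Sum>i\<le>k. monom (poly (c i) z) i) (F + mat z ** G) = 0"
      unfolding p_def by (simp add: vec_eq_iff)
  next
    fix z q
    assume z: "poly (D * c k) z \<noteq> 0" and q: "mat_poly q (F + mat z ** G) = 0" "degree q < k"
    have "(\<Sum>i<k. coeff q i * poly (v i x) z) = 0" for x
      using mat_poly_nth[OF q(2), of "F + mat z ** G" "fst x" "snd x"] q(1) by (simp add: v)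
    then have "coeff q i = 0" if "i < k" for i
      using D(2)[rule_format, of z "coeff q"] z that by simp
    then show "q = 0" using q(2) leading_coeff_0_iff by blast
  qed (use D \<open>c k \<noteq> 0\<close> in auto)
qed

section \<open>Forms vanishing on the determinantal curve\<close>

lemma hom_poly_scale: "hom_poly n f \<Longrightarrow> f (c *s u) = c ^ n * f u"
proof -
  assume "hom_poly n f"
  then obtain a where f: "\<And>u. f u = (\<Sum>i\<le>n. \<Sum>j\<le>n - i. a i j * u $ 1 ^ i * u $ 2 ^ j * u $ 3 ^ (n - i - j))"
    unfolding hom_poly_def by blast
  have "c ^ n = c ^ i * c ^ j * c ^ (n - i - j)" if "i \<le> n" "j \<le> n - i" for i j
    using that by (simp flip: power_add)
  then show ?thesis
    unfolding f sum_distrib_left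
    by (intro sum.cong refl) (simp add: power_mult_distrib mult_ac)
qed

lemma hom_poly_monomial:
  assumes "i + j + l = n"
  shows "hom_poly n (\<lambda>u. a * u $ 1 ^ i * u $ 2 ^ j * u $ 3 ^ l)"
  unfolding hom_poly_def
proof (intro exI allI)
  fix u :: "complex^3"
  have "(\<Sum>i'\<le>n. \<Sum>j'\<le>n - i'. (if i' = i \<and> j' = j then a else 0) * u $ 1 ^ i' * u $ 2 ^ j' * u $ 3 ^ (n - i' - j'))
    = (\<Sum>i'\<le>n. \<Sum>j'\<le>n - i'. if j' = j then if i' = i then a * u $ 1 ^ i * u $ 2 ^ j * u $ 3 ^ l else 0 else 0)"
    unfolding assms[symmetric] by (intro sum.cong refl) simp
  also have "\<dots> = (\<Sum>i'\<le>n. if i' = i then a * u $ 1 ^ i * u $ 2 ^ j * u $ 3 ^ l else 0)"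
    unfolding assms[symmetric] by (intro sum.cong refl) simp
  also have "\<dots> = a * u $ 1 ^ i * u $ 2 ^ j * u $ 3 ^ l"
    using assms by simp
  finally show "a * u $ 1 ^ i * u $ 2 ^ j * u $ 3 ^ l =
    (\<Sum>i'\<le>n. \<Sum>j'\<le>n - i'. (if i' = i \<and> j' = j then a else 0) * u $ 1 ^ i' * u $ 2 ^ j' * u $ 3 ^ (n - i' - j'))" ..
qed

lemma hom_poly_0: "hom_poly n (\<lambda>_. 0)"
  unfolding hom_poly_def by (rule exI[of _ "\<lambda>_ _. 0"]) simp

lemma hom_poly_add:
  assumes "hom_poly n f" "hom_poly n g"
  shows "hom_poly n (\<lambda>u. f u + g u)"
proof -
  obtain a b where
    "\<And>u. f u = (\<Sum>i\<le>n. \<Sum>j\<le>n - i. a i j * u $ 1 ^ i * u $ 2 ^ j * u $ 3 ^ (n - i - j))"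
    "\<And>u. g u = (\<Sum>i\<le>n. \<Sum>j\<le>n - i. b i j * u $ 1 ^ i * u $ 2 ^ j * u $ 3 ^ (n - i - j))"
    using assms unfolding hom_poly_def by blast
  then show ?thesis unfolding hom_poly_def
    by (intro exI[of _ "\<lambda>i j. a i j + b i j"]) (simp add: distrib_right sum.distrib)
qed

lemma hom_poly_sum: "(\<And>i. i \<in> I \<Longrightarrow> hom_poly n (f i)) \<Longrightarrow> hom_poly n (\<lambda>u. \<Sum>i\<in>I. f i u)"
  by (induction I rule: infinite_finite_induct) (simp_all add: hom_poly_0 hom_poly_add)

text \<open>The derivative is a real one but has complex linear form. Functions with this property
  include the constants and coordinates and are closed under sums and products.\<close>

lemma hom_poly_has_derivative_ex:
  assumes "hom_poly n f"
  shows "\<exists>g. (f has_derivative (\<lambda>v. \<Sum>i\<in>UNIV. g $ i * v $ i)) (at u)"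
proof -
  define Q where "Q f \<longleftrightarrow> (\<exists>g. (f has_derivative (\<lambda>v. \<Sum>i\<in>UNIV. g $ i * v $ i)) (at u))"
    for f :: "complex^3 \<Rightarrow> complex"
  have const: "Q (\<lambda>_. c)" for c
    unfolding Q_def by (rule exI[of _ 0]) simp
  have coord: "Q (\<lambda>u. u $ k)" for k
    unfolding Q_def
    by (rule exI[of _ "axis k 1"])
      (simp add: axis_def if_distrib[where f="\<lambda>x. x * _"] bounded_linear_imp_has_derivative bounded_linear_vec_nth cong: if_cong)
  have add: "Q (\<lambda>u. f u + h u)" if fh: "Q f" "Q h" for f h
  proof -
    obtain a b where ab: "(f has_derivative (\<lambda>v. \<Sum>i\<in>UNIV. a $ i * v $ i)) (at u)"
      "(h has_derivative (\<lambda>v. \<Sum>i\<in>UNIV. b $ i * v $ i)) (at u)"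
      using fh unfolding Q_def by blast
    show ?thesis unfolding Q_def
      by (rule exI[of _ "a + b"]) (use has_derivative_add[OF ab] in \<open>simp add: algebra_simps sum.distrib\<close>)
  qed
  have mult: "Q (\<lambda>u. f u * h u)" if fh: "Q f" "Q h" for f h
  proof -
    obtain a b where ab: "(f has_derivative (\<lambda>v. \<Sum>i\<in>UNIV. a $ i * v $ i)) (at u)"
      "(h has_derivative (\<lambda>v. \<Sum>i\<in>UNIV. b $ i * v $ i)) (at u)"
      using fh unfolding Q_def by blast
    show ?thesis unfolding Q_def
      by (rule exI[of _ "f u *s b + h u *s a"])
        (use has_derivative_mult[OF ab] in \<open>simp add: algebra_simps sum.distrib sum_distrib_left\<close>)
  qed
  have power: "Q (\<lambda>u. f u ^ k)" if "Q f" for f k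
    using that by (induction k) (auto intro: const mult)
  have sum: "Q (\<lambda>u. \<Sum>i\<in>I. F i u)" if "\<And>i. Q (F i)" for F :: "nat \<Rightarrow> _" and I
    using that by (induction I rule: infinite_finite_induct) (auto intro: const add)
  obtain a where f: "f = (\<lambda>u. \<Sum>i\<le>n. \<Sum>j\<le>n - i. a i j * u $ 1 ^ i * u $ 2 ^ j * u $ 3 ^ (n - i - j))"
    using assms unfolding hom_poly_def by blast
  have "Q f" unfolding f by (intro sum mult power const coord)
  then show ?thesis unfolding Q_def .
qed

lemma bounded_linear_axis: "bounded_linear (axis i :: 'a::euclidean_space \<Rightarrow> 'a^'n)"
  by (intro linear_conv_bounded_linear[THEN iffD1] linearI) (auto simp: axis_def vec_eq_iff)

text \<open>Restricting to the coordinate axes identifies the coefficients of the derivative with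
  the partial derivatives in \<open>grad\<close>.\<close>

lemma hom_poly_has_derivative:
  assumes "hom_poly n f"
  shows "(f has_derivative (\<lambda>v. \<Sum>i\<in>UNIV. grad f u $ i * v $ i)) (at u)"
proof -
  obtain g where g: "(f has_derivative (\<lambda>v. \<Sum>i\<in>UNIV. g $ i * v $ i)) (at u)"
    using hom_poly_has_derivative_ex[OF assms] by blast
  have "grad f u $ i = g $ i" for i
  proof -
    have axis: "((\<lambda>t. u + axis i t) has_derivative axis i) (at 0)"
      using has_derivative_add[OF has_derivative_const[of u] bounded_linear_imp_has_derivative[OF bounded_linear_axis]]
      by simp
    have eq: "(\<lambda>t. \<Sum>j\<in>UNIV. g $ j * axis i t $ j) = (*) (g $ i)"
      by (auto simp: axis_def if_distrib[where f="\<lambda>x. _ * x"] cong: if_cong)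
    have "(f has_derivative (\<lambda>v. \<Sum>i\<in>UNIV. g $ i * v $ i)) (at (u + axis i 0))"
      using g by (simp add: axis_def vec_eq_iff zero_vec_def plus_vec_def)
    from has_derivative_compose[OF axis this]
    have "((\<lambda>t. f (u + axis i t)) has_field_derivative g $ i) (at 0)"
      by (simp add: eq has_field_derivative_def)
    then show ?thesis by (simp add: grad_def DERIV_imp_deriv)
  qed
  then show ?thesis using g by simp
qed

text \<open>Both sides are the derivative of \<open>f (c *s u)\<close> in the direction
  \<open>v\<close>. It makes tangency independent of the representative of a point; keeping
  \<open>c\<close> on the left avoids the exponent \<open>n - 1\<close>.\<close>

lemma hom_poly_grad_scale:
  assumes "hom_poly n f"
  shows "(\<Sum>i\<in>UNIV. grad f (c *s u) $ i * (c * v $ i)) = c ^ n * (\<Sum>i\<in>UNIV. grad f u $ i * v $ i)"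
proof -
  have "bounded_linear ((*s) c :: complex^3 \<Rightarrow> _)"
    by (intro linear_conv_bounded_linear[THEN iffD1] linearI) (auto simp: vec_eq_iff algebra_simps)
  from has_derivative_compose[OF bounded_linear_imp_has_derivative[OF this] hom_poly_has_derivative[OF assms]]
  have d1: "((\<lambda>u. f (c *s u)) has_derivative (\<lambda>v. \<Sum>i\<in>UNIV. grad f (c *s u) $ i * (c *s v) $ i)) (at u)"
    by blast
  have d2: "((\<lambda>u. f (c *s u)) has_derivative (\<lambda>v. c ^ n * (\<Sum>i\<in>UNIV. grad f u $ i * v $ i))) (at u)"
    unfolding hom_poly_scale[OF assms]
    by (intro has_derivative_mult_right hom_poly_has_derivative[OF assms])
  from fun_cong[OF has_derivative_unique[OF d1 d2], of v] show ?thesis by simp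
qed

text \<open>Euler's relation at a zero: by homogeneity \<open>f\<close> vanishes on the whole line
  through \<open>u\<close>, hence so does its derivative in the direction \<open>u\<close>.\<close>

lemma hom_poly_euler:
  assumes "hom_poly n f" "f u = 0"
  shows "(\<Sum>i\<in>UNIV. grad f u $ i * u $ i) = 0"
proof -
  have "((\<lambda>t::real. u + t *\<^sub>R u) has_derivative (\<lambda>t. t *\<^sub>R u)) (at 0)"
    by (auto intro!: derivative_eq_intros)
  moreover have "(f has_derivative (\<lambda>v. \<Sum>i\<in>UNIV. grad f u $ i * v $ i)) (at (u + 0 *\<^sub>R u))"
    using hom_poly_has_derivative[OF assms(1), of u] by simp
  ultimately have "((\<lambda>t. f (u + t *\<^sub>R u)) has_derivative (\<lambda>t. \<Sum>i\<in>UNIV. grad f u $ i * (t *\<^sub>R u) $ i)) (at 0)"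
    by (rule has_derivative_compose)
  moreover have "f (u + t *\<^sub>R u) = 0" for t
  proof -
    have "u + t *\<^sub>R u = (1 + of_real t) *s u" by (simp add: vec_eq_iff algebra_simps) (simp add: scaleR_conv_of_real)
    then show ?thesis by (simp only: hom_poly_scale[OF assms(1)] assms(2) mult_zero_right)
  qed
  ultimately have "((\<lambda>t::real. 0) has_derivative (\<lambda>t. \<Sum>i\<in>UNIV. grad f u $ i * (t *\<^sub>R u) $ i)) (at 0)"
    by simp
  then have "(\<lambda>t::real. \<Sum>i\<in>UNIV. grad f u $ i * (t *\<^sub>R u) $ i) = (\<lambda>t. 0)"
    by (rule has_derivative_unique) simp
  from fun_cong[OF this, of 1] show ?thesis by simp
qed

section \<open>Equations of the determinantal curve\<close>

lemma det_eq_0_iff: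
  fixes A :: "'a::field^'n^'n"
  shows "det A = 0 \<longleftrightarrow> (\<exists>x. x \<noteq> 0 \<and> A *v x = 0)"
  by (metis invertible_det_nz invertible_left_inverse matrix_left_invertible_ker)

text \<open>A determinant vanishes exactly when the matrix has a kernel, and the kernel survives
  rescaling of the coordinates. Membership in the curve is used below in this form.\<close>

lemma det_curve_iff:
  assumes "u \<noteq> 0"
  shows "proj u \<in> det_curve F G \<longleftrightarrow>
    (\<exists>x. x \<noteq> 0 \<and> u $ 1 *s x + u $ 2 *s (F *v x) + u $ 3 *s (G *v x) = 0)"
proof -
  define N where "N u = (\<chi> i j. u $ 1 * mat 1 $ i $ j + u $ 2 * F $ i $ j + u $ 3 * G $ i $ j)"
    for u :: "complex^3"
  have N: "N u *v x = u $ 1 *s x + u $ 2 *s (F *v x) + u $ 3 *s (G *v x)" for u x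
  proof -
    have "N u = mat (u $ 1) + mat (u $ 2) ** F + mat (u $ 3) ** G"
      by (simp add: N_def vec_eq_iff mat_mul_nth) (simp add: mat_def)
    then show ?thesis
      by (simp add: matrix_vector_mult_add_rdistrib mat_mult_vec flip: matrix_vector_mul_assoc)
  qed
  have scale: "N (c *s u) *v x = c *s (N u *v x)" for c u x
    unfolding N by (simp add: vec_eq_iff algebra_simps)
  have "proj u \<in> det_curve F G \<longleftrightarrow> (\<exists>w. proj u = proj w \<and> w \<noteq> 0 \<and> det (N w) = 0)"
    by (auto simp: det_curve_def N_def)
  also have "\<dots> \<longleftrightarrow> det (N u) = 0"
  proof
    assume "\<exists>w. proj u = proj w \<and> w \<noteq> 0 \<and> det (N w) = 0"
    then obtain w x where w: "proj w = proj u" "w \<noteq> 0" "x \<noteq> 0" "N w *v x = 0"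
      by (metis det_eq_0_iff)
    obtain c where "u = c *s w"
      using w(1) proj_eq_iff[OF w(2) assms] by blast
    then have "N u *v x = 0" using w by (simp add: scale)
    then show "det (N u) = 0" using w det_eq_0_iff by blast
  qed (use assms in blast)
  finally show ?thesis by (simp add: det_eq_0_iff N)
qed

lemma poly_eq_sum_atMost:
  fixes p :: "'a::comm_semiring_1 poly"
  assumes "degree p \<le> m"
  shows "poly p z = (\<Sum>j\<le>m. coeff p j * z ^ j)"
proof -
  have "(\<Sum>j\<le>degree p. coeff p j * z ^ j) = (\<Sum>j\<le>m. coeff p j * z ^ j)"
    using assms by (intro sum.mono_neutral_left) (auto simp: coeff_eq_0)
  then show ?thesis by (simp add: poly_altdef)
qed

text \<open>The form homogenises the minimal polynomial of the pencil. Its first partial derivative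
  at the point is minus the derivative of the specialised polynomial at the eigenvalue, nonzero
  because hermitian minimal polynomials have simple roots. \<open>B\<close> consists of the real
  zeros of \<open>D\<close>.\<close>

lemma det_curve_form_simple_root:
  fixes F G :: "complex^'n^'n"
  assumes "hermitian F" "hermitian G"
  obtains B where "finite B"
    and "\<And>s l x. s \<notin> B \<Longrightarrow> x \<noteq> 0 \<Longrightarrow> F *v x + of_real s *s (G *v x) = of_real l *s x \<Longrightarrow>
      \<exists>f\<in>vanishing_forms (det_curve F G). grad f (vector [- of_real l, 1, of_real s]) $ 1 \<noteq> 0"
proof -
  obtain c k D
    where ann: "\<And>z. mat_poly (\<Sum>i\<le>k. monom (poly (c i) z) i) (F + mat z ** G) = 0"
      and D: "D \<noteq> 0"
      and ck: "\<And>z. poly D z \<noteq> 0 \<Longrightarrow> poly (c k) z \<noteq> 0"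
      and minimal: "\<And>z q. poly D z \<noteq> 0 \<Longrightarrow> mat_poly q (F + mat z ** G) = 0 \<Longrightarrow> degree q < k \<Longrightarrow> q = 0"
    by (rule pencil_min_poly[of F G]) blast
  define P where "P z = (\<Sum>i\<le>k. monom (poly (c i) z) i)" for z
  define m where "m = Max ((\<lambda>i. degree (c i)) ` {..k})"
  have m: "degree (c i) \<le> m" if "i \<le> k" for i
    unfolding m_def using that by (intro Max_ge) auto
  \<comment> \<open>Homogenisation with \<open>- u $ 1 / u $ 2\<close> as eigenvalue and
    \<open>u $ 3 / u $ 2\<close> as pencil parameter. The additional factor \<open>u $ 2\<close>,
    coming from \<open>Suc\<close>, makes \<open>f\<close> vanish also at the points with
    \<open>u $ 2 = 0\<close>, to which no member of the pencil corresponds.\<close>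
  define f where "f u = (\<Sum>i\<le>k. \<Sum>j\<le>m. (coeff (c i) j * (- 1) ^ i) * u $ 1 ^ i *
      u $ 2 ^ Suc ((k - i) + (m - j)) * u $ 3 ^ j)" for u :: "complex^3"
  have hom: "hom_poly (Suc (k + m)) f"
    unfolding f_def by (intro hom_poly_sum hom_poly_monomial) auto
  have f_eq: "f u = u $ 2 ^ Suc (k + m) * poly (P (u $ 3 / u $ 2)) (- u $ 1 / u $ 2)" if "u $ 2 \<noteq> 0" for u
  proof -
    have "(coeff (c i) j * (- 1) ^ i) * u $ 1 ^ i * u $ 2 ^ Suc ((k - i) + (m - j)) * u $ 3 ^ j =
       u $ 2 ^ Suc (k + m) * (coeff (c i) j * (u $ 3 / u $ 2) ^ j * (- u $ 1 / u $ 2) ^ i)"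
      if "i \<le> k" "j \<le> m" for i j
    proof -
      have e: "Suc (k + m) = Suc ((k - i) + (m - j)) + (i + j)" using that by simp
      have "u $ 2 ^ Suc (k + m) = u $ 2 ^ Suc ((k - i) + (m - j)) * (u $ 2 ^ i * u $ 2 ^ j)"
        unfolding e power_add ..
      moreover have "(- u $ 1 / u $ 2) ^ i = (- 1) ^ i * u $ 1 ^ i / u $ 2 ^ i"
        by (metis power_divide power_minus)
      ultimately show ?thesis using \<open>u $ 2 \<noteq> 0\<close> by (simp add: power_divide)
    qed
    then have "f u = (\<Sum>i\<le>k. \<Sum>j\<le>m.
        u $ 2 ^ Suc (k + m) * (coeff (c i) j * (u $ 3 / u $ 2) ^ j * (- u $ 1 / u $ 2) ^ i))"
      unfolding f_def by (intro sum.cong refl) simp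
    also have "\<dots> = u $ 2 ^ Suc (k + m) * (\<Sum>i\<le>k. poly (c i) (u $ 3 / u $ 2) * (- u $ 1 / u $ 2) ^ i)"
      by (simp add: sum_distrib_left sum_distrib_right poly_eq_sum_atMost[OF m])
    finally show ?thesis by (simp add: P_def poly_sum poly_monom)
  qed
  have pencil: "(F + mat z ** G) *v x = F *v x + z *s (G *v x)" for x z
    by (simp add: matrix_vector_mult_add_rdistrib mat_mult_vec flip: matrix_vector_mul_assoc)
  have "f u = 0" if u: "u \<noteq> 0" "proj u \<in> det_curve F G" for u
  proof (cases "u $ 2 = 0")
    case True
    then show ?thesis by (simp add: f_def)
  next
    case False
    obtain x where x: "x \<noteq> 0" "u $ 1 *s x + u $ 2 *s (F *v x) + u $ 3 *s (G *v x) = 0"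
      using u det_curve_iff by blast
    then have "(F + mat (u $ 3 / u $ 2) ** G) *v x = (- u $ 1 / u $ 2) *s x"
      using False unfolding pencil by (auto simp: vec_eq_iff field_simps eq_neg_iff_add_eq_0)
    from mat_poly_eigenvector[OF this, of "P (u $ 3 / u $ 2)"]
    have "poly (P (u $ 3 / u $ 2)) (- u $ 1 / u $ 2) = 0"
      using x(1) ann unfolding P_def by (auto simp: vec_eq_iff)
    then show ?thesis using f_eq[OF False] by simp
  qed
  then have vanish: "f \<in> vanishing_forms (det_curve F G)"
    unfolding vanishing_forms_def using hom by blast
  show ?thesis
  proof (rule that[of "{s. poly D (of_real s) = 0}"])
    have "finite (of_real -` {z. poly D z = 0} :: real set)"
      using poly_roots_finite[OF D] by (intro finite_vimageI) (auto simp: inj_on_def)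
    then show "finite {s::real. poly D (of_real s) = 0}" by (simp add: vimage_def)
  next
    fix s l x
    assume s: "s \<notin> {s. poly D (of_real s) = 0}"
      and x: "x \<noteq> 0" "F *v x + of_real s *s (G *v x) = of_real l *s x"
    define A where "A = F + mat (of_real s) ** G"
    have "hermitian A"
      using assms unfolding A_def hermitian_def mat_adj_def
      by (simp add: vec_eq_iff mat_mul_nth)
    moreover have "mat_poly (P (of_real s)) A = 0" using ann by (simp add: A_def P_def)
    moreover have deg: "degree (P (of_real s)) = k" "P (of_real s) \<noteq> 0"
    proof -
      have "coeff (P (of_real s)) k = poly (c k) (of_real s)"
        by (simp add: P_def coeff_sum)
      then have "coeff (P (of_real s)) k \<noteq> 0" using ck s by simp
      moreover have "degree (P (of_real s)) \<le> k"
        unfolding P_def by (auto intro!: degree_sum_le order.trans[OF degree_monom_le])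
      ultimately show "degree (P (of_real s)) = k" "P (of_real s) \<noteq> 0"
        using le_degree by (auto intro: antisym)
    qed
    moreover have "q = 0" if "mat_poly q A = 0" "degree q < degree (P (of_real s))" for q
      using minimal[of "of_real s" q] that s unfolding A_def deg(1) by simp
    moreover have "A *v x = of_real l *s x" using x unfolding A_def pencil by simp
    ultimately have root: "poly (pderiv (P (of_real s))) (of_real l) \<noteq> 0"
      using hermitian_min_poly_simple_root(2) x(1) by blast
    have "f (vector [- of_real l, 1, of_real s] + axis 1 t) = poly (P (of_real s)) (of_real l - t)" for t
      by (subst f_eq) (simp_all add: vector_3 axis_def)
    moreover have "((\<lambda>t. poly (P (of_real s)) (of_real l - t)) has_field_derivative
        - poly (pderiv (P (of_real s))) (of_real l)) (at 0)"
      by (auto intro!: derivative_eq_intros)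
    ultimately have "grad f (vector [- of_real l, 1, of_real s]) $ 1 = - poly (pderiv (P (of_real s))) (of_real l)"
      by (simp add: grad_def DERIV_imp_deriv)
    then show "\<exists>f\<in>vanishing_forms (det_curve F G). grad f (vector [- of_real l, 1, of_real s]) $ 1 \<noteq> 0"
      using vanish root by (intro bexI[of _ f]) auto
  qed
qed

section \<open>Tangents along the eigenvalue branch\<close>

lemma norm_axis: "norm (axis i t) = norm t"
  by (simp add: norm_vec_def L2_set_def axis_def if_distrib[where f="\<lambda>x. (norm x)\<^sup>2"] cong: if_cong)

text \<open>Since \<open>f\<close> is zero along \<open>p\<close>, its first-order expansion at
  \<open>p s\<close> equates the gradient term with a remainder, which by the Lipschitz bound is
  small against \<open>\<sigma> - s\<close>. Differentiability of \<open>\<mu>\<close> is not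
  assumed; it will be deduced from this limit.\<close>

lemma vanishing_form_difference_quotient:
  fixes \<mu> :: "real \<Rightarrow> real"
  defines "p \<equiv> \<lambda>\<sigma>. vector [- of_real (\<mu> \<sigma>), 1, of_real \<sigma>] :: complex^3"
  assumes f: "f \<in> vanishing_forms S"
    and curve: "\<And>\<sigma>. proj (p \<sigma>) \<in> S"
    and lip: "\<And>\<sigma>. \<bar>\<mu> \<sigma> - \<mu> s\<bar> \<le> C * \<bar>\<sigma> - s\<bar>"
  shows "((\<lambda>\<sigma>. grad f (p s) $ 1 * of_real ((\<mu> \<sigma> - \<mu> s) / (\<sigma> - s))) \<longlongrightarrow> grad f (p s) $ 3) (at s)"
proof (rule tendstoI)
  fix e :: real assume e: "e > 0"
  have "p \<sigma> $ 2 = 1" for \<sigma> by (simp add: p_def)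
  then have p0: "p \<sigma> \<noteq> 0" for \<sigma> by (metis zero_index zero_neq_one)
  have fp: "f (p \<sigma>) = 0" for \<sigma>
    using f curve p0 unfolding vanishing_forms_def by blast
  obtain n where n: "hom_poly n f" using f unfolding vanishing_forms_def by blast
  define g where "g = grad f (p s)"
  have C: "C \<ge> 0" using lip[of "s + 1"] by simp
  \<comment> \<open>The increment of \<open>p\<close> is at most
    \<open>(C + 1) * \<bar>\<sigma> - s\<bar>\<close>, so this choice bounds the remainder by
    \<open>e / 2 * \<bar>\<sigma> - s\<bar>\<close> and leaves room for the strict
    inequality.\<close>
  define e' where "e' = e / (2 * (C + 1))"
  have e': "e' > 0" using e C by (simp add: e'_def)
  obtain d where d: "d > 0" "\<And>y. norm (y - p s) < d \<Longrightarrow>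
      norm (f y - f (p s) - (\<Sum>i\<in>UNIV. g $ i * (y - p s) $ i)) \<le> e' * norm (y - p s)"
    using hom_poly_has_derivative[OF n, of "p s"] e' unfolding has_derivative_at_alt g_def by blast
  have "dist (g $ 1 * of_real ((\<mu> \<sigma> - \<mu> s) / (\<sigma> - s))) (g $ 3) < e"
    if \<sigma>: "\<sigma> \<noteq> s" "dist \<sigma> s < d / (C + 1)" for \<sigma>
  proof -
    have "p \<sigma> - p s = axis 1 (of_real (\<mu> s - \<mu> \<sigma>)) + axis 3 (of_real (\<sigma> - s))"
      by (simp add: p_def vec_eq_iff forall_3 axis_def)
    then have "norm (p \<sigma> - p s) \<le> \<bar>\<mu> s - \<mu> \<sigma>\<bar> + \<bar>\<sigma> - s\<bar>"
      by (metis norm_triangle_ineq norm_axis norm_of_real)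
    then have le: "norm (p \<sigma> - p s) \<le> (C + 1) * \<bar>\<sigma> - s\<bar>"
      using lip[of \<sigma>] by (simp add: abs_minus_commute distrib_right)
    also have "\<dots> < d" using \<sigma>(2) C by (simp add: dist_real_def field_simps)
    finally have "norm (\<Sum>i\<in>UNIV. g $ i * (p \<sigma> - p s) $ i) \<le> e' * norm (p \<sigma> - p s)"
      using d(2)[of "p \<sigma>"] by (simp add: fp)
    also have "\<dots> \<le> e' * ((C + 1) * \<bar>\<sigma> - s\<bar>)"
      using le e' by (intro mult_left_mono) auto
    also have "\<dots> = e / 2 * \<bar>\<sigma> - s\<bar>" using C by (simp add: e'_def field_simps)
    also have "(\<Sum>i\<in>UNIV. g $ i * (p \<sigma> - p s) $ i) =
        - of_real (\<sigma> - s) * (g $ 1 * of_real ((\<mu> \<sigma> - \<mu> s) / (\<sigma> - s)) - g $ 3)"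
      using \<sigma>(1) by (simp add: sum_3 p_def) (simp add: field_simps)
    finally have "\<bar>\<sigma> - s\<bar> * norm (g $ 1 * of_real ((\<mu> \<sigma> - \<mu> s) / (\<sigma> - s)) - g $ 3) \<le> \<bar>\<sigma> - s\<bar> * (e / 2)"
      by (simp only: norm_mult norm_minus_cancel norm_of_real mult.commute)
    then have "norm (g $ 1 * of_real ((\<mu> \<sigma> - \<mu> s) / (\<sigma> - s)) - g $ 3) \<le> e / 2"
      using \<sigma>(1) by (simp only: mult_le_cancel_left_pos zero_less_abs_iff right_minus_eq not_False_eq_True)
    then show ?thesis using e by (simp add: dist_norm)
  qed
  moreover have "d / (C + 1) > 0" using d C by simp
  ultimately show "\<forall>\<^sub>F \<sigma> in at s. dist (grad f (p s) $ 1 * of_real ((\<mu> \<sigma> - \<mu> s) / (\<sigma> - s))) (grad f (p s) $ 3) < e"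
    unfolding eventually_at g_def by blast
qed

text \<open>For \<open>f0\<close> the preceding limit can be divided by the nonzero first partial
  derivative, which makes \<open>\<mu>\<close> differentiable. For every other form, uniqueness of
  limits fixes the third partial derivative and Euler's relation the second. So all gradients are
  multiples of one vector, the coordinates of the tangent line.\<close>

lemma dual_curve_tangent:
  fixes \<mu> :: "real \<Rightarrow> real"
  assumes f0: "f0 \<in> vanishing_forms S" "grad f0 (vector [- of_real (\<mu> s), 1, of_real s]) $ 1 \<noteq> 0"
    and curve: "\<And>\<sigma>. proj (vector [- of_real (\<mu> \<sigma>), 1, of_real \<sigma>]) \<in> S"
    and lip: "\<And>\<sigma>. \<bar>\<mu> \<sigma> - \<mu> s\<bar> \<le> C * \<bar>\<sigma> - s\<bar>"
  obtains l where "(\<mu> has_real_derivative l) (at s)"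
    and "proj (vector [1, of_real (\<mu> s - s * l), of_real l]) \<in> dual_curve S"
proof -
  define p where "p = (vector [- of_real (\<mu> s), 1, of_real s] :: complex^3)"
  define Q where "Q \<sigma> = (\<mu> \<sigma> - \<mu> s) / (\<sigma> - s)" for \<sigma>
  have "p $ 2 = 1" by (simp add: p_def)
  then have p0: "p \<noteq> 0" by (metis zero_index zero_neq_one)
  have pS: "proj p \<in> S" using curve by (simp add: p_def)
  have lim: "((\<lambda>\<sigma>. grad f p $ 1 * of_real (Q \<sigma>)) \<longlongrightarrow> grad f p $ 3) (at s)" if "f \<in> vanishing_forms S" for f
    unfolding p_def Q_def using vanishing_form_difference_quotient[OF that curve lip] .
  have g0: "grad f0 p $ 1 \<noteq> 0" using f0(2) by (simp add: p_def)
  \<comment> \<open>The quotient is a limit of real numbers, so \<open>Re\<close> changes only the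
    type.\<close>
  define l where "l = Re (grad f0 p $ 3 / grad f0 p $ 1)"
  have "((\<lambda>\<sigma>. (grad f0 p $ 1 * of_real (Q \<sigma>)) / grad f0 p $ 1) \<longlongrightarrow> grad f0 p $ 3 / grad f0 p $ 1) (at s)"
    by (intro tendsto_divide lim f0 tendsto_const g0)
  from tendsto_Re[OF this] have Q: "(Q \<longlongrightarrow> l) (at s)" using g0 by (simp add: l_def)
  have grad_eq: "grad f p = grad f p $ 1 *s vector [1, of_real (\<mu> s - s * l), of_real l]"
    if f: "f \<in> vanishing_forms S" for f
  proof -
    have "((\<lambda>\<sigma>. grad f p $ 1 * of_real (Q \<sigma>)) \<longlongrightarrow> grad f p $ 1 * of_real l) (at s)"
      by (intro tendsto_intros Q)
    from tendsto_unique[OF _ lim[OF f] this] have 3: "grad f p $ 3 = grad f p $ 1 * of_real l" by simp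
    obtain n where "hom_poly n f" "f p = 0"
      using f pS p0 unfolding vanishing_forms_def by blast
    then have "(\<Sum>i\<in>UNIV. grad f p $ i * p $ i) = 0" by (rule hom_poly_euler)
    then have "grad f p $ 2 = grad f p $ 1 * of_real (\<mu> s) - grad f p $ 3 * of_real s"
      by (simp add: sum_3 p_def algebra_simps add_eq_0_iff)
    with 3 show ?thesis by (simp add: vec_eq_iff forall_3 algebra_simps)
  qed
  define x where "x = (vector [1, of_real (\<mu> s - s * l), of_real l] :: complex^3)"
  have "x $ 1 = 1" by (simp add: x_def)
  then have x0: "x \<noteq> 0" by (metis zero_index zero_neq_one)
  have grad_sum: "(\<Sum>i\<in>UNIV. grad f p $ i * v $ i) = grad f p $ 1 * (\<Sum>i\<in>UNIV. x $ i * v $ i)"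
    if "f \<in> vanishing_forms S" for f v
    by (subst grad_eq[OF that]) (simp add: x_def sum_distrib_left mult.assoc)
  have "smooth_point S (proj p)"
    unfolding smooth_point_def using pS p0 f0(1) g0
    by (metis zero_index)
  moreover have "tangent_space S (proj p) = proj_line (proj x)"
  proof (intro Set.equalityI subsetI)
    fix q assume "q \<in> tangent_space S (proj p)"
    then obtain v u where q: "q = proj v" "v \<noteq> 0" "u \<noteq> 0" "proj p = proj u"
      and v: "(\<Sum>i\<in>UNIV. grad f0 u $ i * v $ i) = 0"
      using f0(1) unfolding tangent_space_def by blast
    obtain c where c: "u = c *s p" using q(4) proj_eq_iff[OF p0 q(3)] by blast
    then have "c \<noteq> 0" using q(3) by auto
    obtain n where n: "hom_poly n f0" using f0(1) unfolding vanishing_forms_def by blast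
    have "c ^ n * (\<Sum>i\<in>UNIV. grad f0 p $ i * v $ i) = c * (\<Sum>i\<in>UNIV. grad f0 u $ i * v $ i)"
      unfolding c hom_poly_grad_scale[OF n, symmetric] by (simp add: sum_distrib_left mult_ac)
    then have "(\<Sum>i\<in>UNIV. x $ i * v $ i) = 0"
      using v \<open>c \<noteq> 0\<close> g0 grad_sum[OF f0(1)] by simp
    then show "q \<in> proj_line (proj x)"
      unfolding proj_line_def using q x0 by blast
  next
    fix q assume "q \<in> proj_line (proj x)"
    then obtain v y where q: "q = proj v" "v \<noteq> 0" "y \<noteq> 0" "proj x = proj y"
      and v: "(\<Sum>i\<in>UNIV. y $ i * v $ i) = 0"
      unfolding proj_line_def by blast
    obtain c where c: "y = c *s x" using q(4) proj_eq_iff[OF x0 q(3)] by blast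
    then have "c \<noteq> 0" using q(3) by auto
    moreover have "c * (\<Sum>i\<in>UNIV. x $ i * v $ i) = 0"
      using v unfolding c by (simp add: sum_distrib_left mult.assoc)
    ultimately have "\<forall>f\<in>vanishing_forms S. (\<Sum>i\<in>UNIV. grad f p $ i * v $ i) = 0"
      using grad_sum by simp
    then show "q \<in> tangent_space S (proj p)"
      unfolding tangent_space_def using q p0 by blast
  qed
  ultimately have "proj x \<in> dual_curve S"
    unfolding dual_curve_def zariski_closure_def using x0
    by (auto simp: vanishing_forms_def intro!: exI[of _ x])
  moreover have "(\<mu> has_real_derivative l) (at s)"
    using Q unfolding Q_def has_field_derivative_iff .
  ultimately show ?thesis using that unfolding x_def by blast
qed

lemma hom_poly_continuous: "hom_poly n f \<Longrightarrow> continuous_on A f"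
  by (meson continuous_at_imp_continuous_on hom_poly_has_derivative has_derivative_continuous)

lemma zariski_closure_iff:
  assumes "u \<noteq> 0"
  shows "proj u \<in> zariski_closure S \<longleftrightarrow> (\<forall>f\<in>vanishing_forms S. f u = 0)"
proof
  assume "proj u \<in> zariski_closure S"
  then obtain w where w: "w \<noteq> 0" "proj w = proj u" "\<forall>f\<in>vanishing_forms S. f w = 0"
    unfolding zariski_closure_def by force
  obtain c where "u = c *s w" using w(2) proj_eq_iff[OF w(1) assms] by blast
  moreover have "\<exists>n. hom_poly n f" if "f \<in> vanishing_forms S" for f
    using that unfolding vanishing_forms_def by blast
  ultimately show "\<forall>f\<in>vanishing_forms S. f u = 0"
    using w(3) hom_poly_scale by (metis mult_zero_right)
qed (use assms in \<open>auto simp: zariski_closure_def\<close>)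

text \<open>In the affine chart a Zariski closure is the common zero set of forms, and these are
  continuous.\<close>

lemma closed_boundary_generating_curve: "closed (boundary_generating_curve F G)"
proof -
  define V where "V = vanishing_forms {q. \<exists>p. smooth_point (det_curve F G) p \<and>
    tangent_space (det_curve F G) p = proj_line q}"
  define h where "h x = (vector [1, of_real (fst x), of_real (snd x)] :: complex^3)" for x :: "real \<times> real"
  have "h x $ 1 = 1" for x by (simp add: h_def)
  then have "h x \<noteq> 0" for x by (metis zero_index zero_neq_one)
  then have h0: "h x \<noteq> 0" for x by (metis zero_index zero_neq_one)
  have "x \<in> boundary_generating_curve F G \<longleftrightarrow> proj (h x) \<in> dual_curve (det_curve F G)" for x
    by (cases x) (simp add: boundary_generating_curve_def h_def)
  also have "\<dots> x \<longleftrightarrow> x \<in> (\<Inter>f\<in>V. {x. f (h x) = 0})" for x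
    unfolding dual_curve_def V_def by (simp add: zariski_closure_iff[OF h0])
  finally have "boundary_generating_curve F G = (\<Inter>f\<in>V. {x. f (h x) = 0})" by blast
  moreover have "closed {x. f (h x) = 0}" if f: "f \<in> V" for f
  proof -
    have "continuous_on UNIV h"
    proof -
      have "h = (\<lambda>x. \<chi> i. if i = 1 then 1 else if i = 2 then of_real (fst x) else of_real (snd x))"
        by (simp add: fun_eq_iff h_def vec_eq_iff forall_3)
      moreover have "continuous_on UNIV (\<lambda>x::real \<times> real. if i = 1 then 1
          else if i = 2 then complex_of_real (fst x) else of_real (snd x))" for i :: 3
        by (cases "i = 1"; cases "i = 2") (auto intro!: continuous_intros)
      ultimately show ?thesis by (simp add: continuous_on_vec_lambda)
    qed
    moreover obtain n where "hom_poly n f" using f unfolding V_def vanishing_forms_def by blast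
    ultimately have "continuous_on UNIV (\<lambda>x. f (h x))"
      using continuous_on_compose2[OF hom_poly_continuous[of _ f UNIV]] by blast
    then show ?thesis by (rule closed_Collect_eq) simp
  qed
  ultimately show ?thesis by auto
qed

section \<open>Support of the numerical range\<close>

lemma pos_semidef_iff: "pos_semidef A \<longleftrightarrow> hermitian A \<and> (\<forall>x. 0 \<le> x \<bullet> (A *v x))"
  by (simp add: pos_semidef_def inner_vec_complex)

lemma complex_matrix_vector_mult_scaleR: "A *v (c *\<^sub>R x) = c *\<^sub>R (A *v x)" for x :: "complex^'n"
  by (simp add: vec_eq_iff matrix_vector_mult_def scaleR_sum_right)

text \<open>\<open>x\<close> minimises the nonnegative quadratic form of \<open>A\<close>, so the
  first variation in the direction \<open>A *v x\<close> must vanish; up to a factor it is the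
  squared norm of \<open>A *v x\<close>.\<close>

lemma pos_semidef_null_vector:
  assumes "pos_semidef A" "x \<bullet> (A *v x) = 0"
  shows "A *v x = 0"
proof -
  have A: "hermitian A" "\<And>x. 0 \<le> x \<bullet> (A *v x)"
    using assms(1) by (auto simp: pos_semidef_iff)
  define y where "y = A *v x"
  define a where "a = y \<bullet> (A *v y)"
  have "0 \<le> t * (2 * (y \<bullet> y) + t * a)" for t
  proof -
    have "(x + t *\<^sub>R y) \<bullet> (A *v (x + t *\<^sub>R y)) = x \<bullet> (A *v x) + t * (2 * (y \<bullet> y) + t * a)"
      using hermitian_inner[OF A(1), of x y]
      by (simp add: matrix_vector_right_distrib a_def y_def
         complex_matrix_vector_mult_scaleR algebra_simps inner_commute)
    then show ?thesis using A(2)[of "x + t *\<^sub>R y"] assms(2) by simp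
  qed
  \<comment> \<open>A negative \<open>t\<close> so small that the linear term outweighs the
    quadratic one; \<open>1 + a\<close> keeps the denominator positive when
    \<open>a = 0\<close>.\<close>
  from this[of "- (y \<bullet> y) / (1 + a)"] have "y \<bullet> y \<le> 0"
  proof -
    have a: "a \<ge> 0" using A(2) by (simp add: a_def)
    have "2 * (y \<bullet> y) + - (y \<bullet> y) / (1 + a) * a = (y \<bullet> y) * (2 + a) / (1 + a)"
      using a by (simp add: field_simps)
    moreover assume "0 \<le> - (y \<bullet> y) / (1 + a) * (2 * (y \<bullet> y) + - (y \<bullet> y) / (1 + a) * a)"
    ultimately have "0 \<le> - ((y \<bullet> y) * (y \<bullet> y)) * ((2 + a) / ((1 + a) * (1 + a)))" by simp
    moreover have "(2 + a) / ((1 + a) * (1 + a)) > 0" using a by simp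
    ultimately have "0 \<le> - ((y \<bullet> y) * (y \<bullet> y))" by (meson zero_le_mult_iff less_le_not_le)
    then show ?thesis by (simp add: mult_le_0_iff)
  qed
  then have "y = 0" by (metis inner_ge_zero antisym inner_eq_zero_iff)
  then show ?thesis by (simp add: y_def)
qed

text \<open>Cholesky elimination instead of a spectral decomposition: a column \<open>y\<close> with
  diagonal entry \<open>r > 0\<close> splits off the rank one matrix with entries
  \<open>y $ i * cnj (y $ k) / r\<close>, which contributes \<open>y \<bullet> (A *v y) / r\<close>.
  The Schur complement \<open>R'\<close> is again positive semidefinite and has fewer nonzero
  diagonal entries.\<close>

lemma trace_mult_pos_semidef_nonneg:
  assumes A: "pos_semidef A" and R: "pos_semidef R"
  shows "0 \<le> Re (trace (A ** R))"
  using R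
proof (induction "card {j. R $ j $ j \<noteq> 0}" arbitrary: R rule: less_induct)
  case (less R)
  have R: "hermitian R" "\<And>x. 0 \<le> x \<bullet> (R *v x)" using less.prems by (auto simp: pos_semidef_iff)
  have col: "(R *v axis j 1) $ i = R $ i $ j" for i j
    by (simp add: matrix_vector_mult_def axis_def if_distrib[where f="\<lambda>x. _ * x"] cong: if_cong)
  have diag: "axis j 1 \<bullet> (R *v axis j 1) = Re (R $ j $ j)" for j
    by (simp add: inner_axis' col inner_complex_def)
  have diag_im: "Im (R $ j $ j) = 0" for j
    using hermitian_nth[OF R(1), of j j] by (simp add: complex_eq_iff)
  show ?case
  proof (cases "\<forall>j. R $ j $ j = 0")
    case True
    have "R $ i $ j = 0" for i j
      using pos_semidef_null_vector[OF less.prems, of "axis j 1"] True diag[of j] col[of j i] by simp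
    then have "R = 0" by (simp add: vec_eq_iff)
    then show ?thesis by (simp add: trace_def matrix_matrix_mult_def)
  next
    case False
    then obtain j where j: "R $ j $ j \<noteq> 0" by blast
    define r where "r = Re (R $ j $ j)"
    have r: "R $ j $ j = of_real r" "r > 0"
      using diag_im[of j] R(2)[of "axis j 1"] j diag[of j]
      by (auto simp: r_def complex_eq_iff order_less_le)
    define y where "y = R *v axis j 1"
    have y: "y $ i = R $ i $ j" for i by (simp add: y_def col)
    define R' where "R' = (\<chi> i k. R $ i $ k - y $ i * cnj (y $ k) / of_real r)"
    have herm': "hermitian R'"
      using hermitian_nth[OF R(1)] by (simp add: hermitian_def mat_adj_def vec_eq_iff R'_def mult.commute)
    have Rx: "(R *v x) $ j = (\<Sum>k\<in>UNIV. cnj (y $ k) * x $ k)" for x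
      by (simp add: matrix_vector_mult_def y hermitian_nth[OF R(1)])
    have R'x: "R' *v x = R *v x - ((R *v x) $ j / of_real r) *s y" for x
      unfolding Rx by (simp add: vec_eq_iff matrix_vector_mult_def R'_def algebra_simps sum_subtractf
        sum_distrib_left sum_divide_distrib)
    have psd': "pos_semidef R'"
      unfolding pos_semidef_iff
    proof (intro conjI herm' allI)
      fix x
      define c where "c = (R *v x) $ j / of_real r"
      \<comment> \<open>The form of \<open>R'\<close> at \<open>x\<close> is that of
        \<open>R\<close> at \<open>x - c *s axis j 1\<close>, because component \<open>j\<close> of
        \<open>R' *v x\<close> is zero.\<close>
      have "(R' *v x) = R *v (x - c *s axis j 1)"
        by (simp add: R'x c_def y_def matrix_vector_mult_diff_distrib vector_scalar_commute)
      moreover have "(c *s axis j 1) \<bullet> (R' *v x) = 0"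
      proof -
        have "(R' *v x) $ j = 0" using r by (simp add: R'x y)
        then show ?thesis by (simp add: inner_vec_complex axis_def if_distrib[where f=cnj]
          if_distrib[where f="\<lambda>x. x * _"] if_distrib[where f="\<lambda>x. _ * x"] cong: if_cong)
      qed
      ultimately have "x \<bullet> (R' *v x) = (x - c *s axis j 1) \<bullet> (R *v (x - c *s axis j 1))"
        by (simp add: inner_diff_left)
      then show "0 \<le> x \<bullet> (R' *v x)" using R(2) by simp
    qed
    have "R' $ j $ j = 0" using r by (simp add: R'_def y)
    \<comment> \<open>A zero diagonal entry of \<open>R\<close> forces a zero column, so elimination
      creates no new nonzero diagonal entry while removing the one at \<open>j\<close>.\<close>
    moreover have "R' $ i $ i = 0" if "R $ i $ i = 0" for i
    proof -
      have "R *v axis i 1 = 0"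
        using pos_semidef_null_vector[OF less.prems, of "axis i 1"] that diag[of i] by simp
      then have "R $ j $ i = 0" using col[of i j] by simp
      then have "y $ i = 0" using hermitian_nth[OF R(1), of j i] by (simp add: y)
      then show ?thesis using that by (simp add: R'_def)
    qed
    ultimately have "{i. R' $ i $ i \<noteq> 0} \<subset> {i. R $ i $ i \<noteq> 0}" using j by blast
    then have IH: "0 \<le> Re (trace (A ** R'))"
      by (intro less.hyps psd' psubset_card_mono) auto
    have "trace (A ** R) = trace (A ** R') + (\<Sum>i\<in>UNIV. cnj (y $ i) * (A *v y) $ i) / of_real r"
      by (simp add: trace_def matrix_matrix_mult_def matrix_vector_mult_def R'_def algebra_simps
         sum_subtractf sum_distrib_left sum_divide_distrib flip: sum.distrib)
    then have "Re (trace (A ** R)) = Re (trace (A ** R')) + y \<bullet> (A *v y) / r"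
      by (simp add: inner_vec_complex)
    moreover have "y \<bullet> (A *v y) \<ge> 0" using A by (simp add: pos_semidef_iff)
    ultimately show ?thesis using IH r by simp
  qed
qed

section \<open>Quadratic forms and supporting directions\<close>

definition qform :: "complex^'n^'n \<Rightarrow> complex^'n \<Rightarrow> real" where
  "qform A x = x \<bullet> (A *v x)"

lemma qform_continuous: "continuous_on S (qform A)"
  unfolding qform_def
  by (intro continuous_intros linear_continuous_on linear_conv_bounded_linear[THEN iffD1])
    (auto intro!: linearI simp: matrix_vector_right_distrib complex_matrix_vector_mult_scaleR)

lemma qform_scaleR: "qform A (c *\<^sub>R x) = c\<^sup>2 * qform A x"
  by (simp add: qform_def complex_matrix_vector_mult_scaleR power2_eq_square)

text \<open>The quadratic form attains its maximum \<open>l\<close> on the unit sphere. Then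
  \<open>mat (of_real l) - A\<close> is positive semidefinite and its form vanishes at the
  maximiser, which therefore lies in its kernel.\<close>

lemma hermitian_top_eigenvector:
  fixes A :: "complex^'n^'n"
  assumes "hermitian A"
  obtains x l where "norm x = 1" "A *v x = of_real l *s x" "qform A x = l"
    and "\<And>y. norm y = 1 \<Longrightarrow> qform A y \<le> l"
    and "pos_semidef (mat (of_real l) - A)"
proof -
  have "sphere (0::complex^'n) 1 \<noteq> {}" by simp
  from continuous_attains_sup[OF compact_sphere this qform_continuous]
  obtain x where "x \<in> sphere 0 1" "\<forall>y\<in>sphere 0 1. qform A y \<le> qform A x" ..
  then have x: "norm x = 1" "\<And>y. norm y = 1 \<Longrightarrow> qform A y \<le> qform A x" by auto
  define l where "l = qform A x"
  have eval: "(mat (of_real l) - A) *v y = l *\<^sub>R y - A *v y" for y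
  proof -
    have "of_real l *s y = l *\<^sub>R y" by (simp add: vec_eq_iff) (simp add: scaleR_conv_of_real)
    then show ?thesis by (simp add: matrix_vector_mult_diff_rdistrib mat_mult_vec)
  qed
  have psd: "pos_semidef (mat (of_real l) - A)"
    unfolding pos_semidef_iff
  proof (intro conjI allI)
    show "hermitian (mat (of_real l) - A)"
      using assms by (auto simp: hermitian_def mat_adj_def vec_eq_iff mat_def)
    fix y
    show "0 \<le> y \<bullet> ((mat (of_real l) - A) *v y)"
    proof (cases "y = 0")
      case False
      have "qform A y = (norm y)\<^sup>2 * qform A ((1 / norm y) *\<^sub>R y)"
        using False by (simp add: qform_scaleR power_divide)
      also have "\<dots> \<le> (norm y)\<^sup>2 * l"
        using x(2)[of "(1 / norm y) *\<^sub>R y"] False by (intro mult_left_mono) (auto simp: l_def)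
      finally show ?thesis
        by (simp add: eval inner_diff_right qform_def dot_square_norm mult.commute)
    qed simp
  qed
  moreover have "x \<bullet> ((mat (of_real l) - A) *v x) = 0"
    using x(1) by (simp add: eval inner_diff_right dot_square_norm) (simp add: l_def qform_def)
  ultimately have "(mat (of_real l) - A) *v x = 0" by (rule pos_semidef_null_vector)
  then have "A *v x = of_real l *s x" by (simp add: matrix_vector_mult_diff_rdistrib mat_mult_vec)
  with x psd show ?thesis unfolding l_def by (intro that[of x "qform A x"] refl)
qed

lemma hermitian_real_pencil:
  assumes "hermitian F" "hermitian G"
  shows "hermitian (mat (of_real a) ** F + mat (of_real b) ** G)"
  using assms by (simp add: hermitian_def mat_adj_def vec_eq_iff mat_mul_nth)

lemma real_pencil_mult:
  fixes F G :: "complex^'n^'n"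
  shows "(mat (of_real a) ** F + mat (of_real b) ** G) *v x = a *\<^sub>R (F *v x) + b *\<^sub>R (G *v x)"
proof -
  have "of_real c *s y = c *\<^sub>R y" for c and y :: "complex^'n"
    by (simp add: vec_eq_iff) (simp add: scaleR_conv_of_real)
  then show ?thesis
    by (simp add: matrix_vector_mult_add_rdistrib mat_mult_vec flip: matrix_vector_mul_assoc)
qed

lemma qform_real_pencil:
  "qform (mat (of_real a) ** F + mat (of_real b) ** G) x = a * qform F x + b * qform G x"
  by (simp add: qform_def real_pencil_mult inner_add_right)

text \<open>Expands the nonnegative trace of the product of the given matrix with a density matrix
  of trace one.\<close>

lemma convex_support_le:
  fixes F G :: "complex^'n^'n"
  assumes "hermitian F" "hermitian G" "w \<in> convex_support F G"
    and psd: "pos_semidef (mat (of_real l) - (mat (of_real a) ** F + mat (of_real b) ** G))"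
  shows "a * fst w + b * snd w \<le> l"
proof -
  obtain R where R: "trace R = 1" "pos_semidef R"
    and w: "w = (Re (hs_inner F R), Re (hs_inner G R))"
    using assms(3) unfolding convex_support_def density_matrices_def by blast
  have "0 \<le> Re (trace ((mat (of_real l) - (mat (of_real a) ** F + mat (of_real b) ** G)) ** R))"
    by (rule trace_mult_pos_semidef_nonneg[OF psd R(2)])
  also have "(mat (of_real l) - (mat (of_real a) ** F + mat (of_real b) ** G)) ** R =
      mat (of_real l) ** R - (mat (of_real a) ** (F ** R) + mat (of_real b) ** (G ** R))"
  proof -
    have "(A - B) ** C = A ** C - B ** C" for A B C :: "complex^'n^'n"
      by (simp add: vec_eq_iff matrix_matrix_mult_def left_diff_distrib sum_subtractf)
    moreover have "(A + B) ** C = A ** C + B ** C" for A B C :: "complex^'n^'n"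
      by (simp add: vec_eq_iff matrix_matrix_mult_def distrib_right sum.distrib)
    ultimately show ?thesis by (simp flip: matrix_mul_assoc)
  qed
  also have "trace \<dots> = of_real l * trace R - (of_real a * trace (F ** R) + of_real b * trace (G ** R))"
    by (simp add: trace_def mat_mul_nth sum_subtractf sum.distrib sum_distrib_left)
  finally show ?thesis
    using assms(1,2) R(1) by (simp add: w hs_inner_def hermitian_def)
qed

text \<open>Allowing both signs of \<open>a\<close> covers the two directions of slope
  \<open>s\<close>: the branch \<open>\<mu>\<close> is the largest eigenvalue of
  \<open>F + s G\<close> for \<open>a > 0\<close> and the smallest for \<open>a < 0\<close>. The
  tangent point of the branch is identified with the value of the forms at the eigenvector.\<close>

lemma generic_support_point:
  fixes F G :: "complex^'n^'n"
  assumes F: "hermitian F" and G: "hermitian G"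
  obtains B where "finite B"
    and "\<And>a s. a \<noteq> 0 \<Longrightarrow> s \<notin> B \<Longrightarrow> \<exists>x. norm x = 1 \<and>
      (qform F x, qform G x) \<in> boundary_generating_curve F G \<and>
      (\<forall>w\<in>convex_support F G. a * fst w + a * s * snd w \<le> a * qform F x + a * s * qform G x)"
proof -
  obtain B where B: "finite B"
    and form: "\<And>s l x. s \<notin> B \<Longrightarrow> x \<noteq> 0 \<Longrightarrow> F *v x + of_real s *s (G *v x) = of_real l *s x \<Longrightarrow>
      \<exists>f\<in>vanishing_forms (det_curve F G). grad f (vector [- of_real l, 1, of_real s]) $ 1 \<noteq> 0"
    using det_curve_form_simple_root[OF F G] by blast
  have "compact (qform G ` sphere 0 1)"
    by (intro compact_continuous_image qform_continuous compact_sphere)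
  then obtain C where "\<forall>r\<in>qform G ` sphere 0 1. norm r \<le> C"
    using compact_imp_bounded bounded_iff by metis
  then have C: "\<And>y. norm y = 1 \<Longrightarrow> \<bar>qform G y\<bar> \<le> C" by simp
  have "\<exists>x. norm x = 1 \<and>
      (qform F x, qform G x) \<in> boundary_generating_curve F G \<and>
      (\<forall>w\<in>convex_support F G. a * fst w + a * s * snd w \<le> a * qform F x + a * s * qform G x)"
    if a: "a \<noteq> 0" and s: "s \<notin> B" for a s :: real
  proof -
    define H where "H \<sigma> = mat (of_real a) ** F + mat (of_real (a * \<sigma>)) ** G" for \<sigma> :: real
    have qH: "qform (H \<sigma>) y = a * (qform F y + \<sigma> * qform G y)" for \<sigma> y
      unfolding H_def qform_real_pencil by (simp add: algebra_simps)
    have "\<exists>x. norm x = 1 \<and> H \<sigma> *v x = of_real (qform (H \<sigma>) x) *s x \<and>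
        (\<forall>y. norm y = 1 \<longrightarrow> qform (H \<sigma>) y \<le> qform (H \<sigma>) x) \<and>
        pos_semidef (mat (of_real (qform (H \<sigma>) x)) - H \<sigma>)" for \<sigma>
      unfolding H_def
      by (rule hermitian_top_eigenvector[OF hermitian_real_pencil[OF F G, of a "a * \<sigma>"]]) blast
    then obtain x where x: "\<And>\<sigma>. norm (x \<sigma>) = 1"
        "\<And>\<sigma>. H \<sigma> *v x \<sigma> = of_real (qform (H \<sigma>) (x \<sigma>)) *s x \<sigma>"
      and max': "\<And>\<sigma> y. norm y = 1 \<Longrightarrow> qform (H \<sigma>) y \<le> qform (H \<sigma>) (x \<sigma>)"
      and psd': "\<And>\<sigma>. pos_semidef (mat (of_real (qform (H \<sigma>) (x \<sigma>))) - H \<sigma>)"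
      by metis
    define l where "l \<sigma> = qform (H \<sigma>) (x \<sigma>)" for \<sigma>
    note x = x[folded l_def] l_def[symmetric] and max = max'[folded l_def] and psd = psd'[folded l_def]
    define \<mu> where "\<mu> \<sigma> = l \<sigma> / a" for \<sigma>
    have eig: "F *v x \<sigma> + of_real \<sigma> *s (G *v x \<sigma>) = of_real (\<mu> \<sigma>) *s x \<sigma>" for \<sigma>
    proof -
      have "a *\<^sub>R (F *v x \<sigma> + of_real \<sigma> *s (G *v x \<sigma>)) = H \<sigma> *v x \<sigma>"
        unfolding H_def real_pencil_mult
        by (simp add: vec_eq_iff scaleR_conv_of_real[where 'a=complex] algebra_simps)
      then have "a *\<^sub>R (F *v x \<sigma> + of_real \<sigma> *s (G *v x \<sigma>)) = a *\<^sub>R (of_real (\<mu> \<sigma>) *s x \<sigma>)"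
        unfolding x(2) using a by (simp add: vec_eq_iff scaleR_conv_of_real[where 'a=complex] \<mu>_def)
      then show ?thesis using a by simp
    qed
    have x0: "x \<sigma> \<noteq> 0" for \<sigma> using x(1)[of \<sigma>] by auto
    have curve: "proj (vector [- of_real (\<mu> \<sigma>), 1, of_real \<sigma>]) \<in> det_curve F G" for \<sigma>
    proof -
      define u where "u = (vector [- of_real (\<mu> \<sigma>), 1, of_real \<sigma>] :: complex^3)"
      have "u \<noteq> 0" by (simp add: u_def vec_eq_iff forall_3)
      moreover have "u $ 1 *s x \<sigma> + u $ 2 *s (F *v x \<sigma>) + u $ 3 *s (G *v x \<sigma>) = 0"
        using eig[of \<sigma>] by (simp add: u_def vec_eq_iff algebra_simps)
      ultimately show ?thesis using det_curve_iff x0 unfolding u_def by blast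
    qed
    \<comment> \<open>At a unit vector the forms of \<open>H \<sigma>\<close> and
      \<open>H \<tau>\<close> differ by \<open>a * (\<sigma> - \<tau>)\<close> times that of
      \<open>G\<close>, which \<open>C\<close> bounds. Evaluating at the top eigenvector of
      \<open>H \<sigma>\<close> gives the estimate.\<close>
    have le: "l \<sigma> \<le> l \<tau> + \<bar>a\<bar> * (C * \<bar>\<sigma> - \<tau>\<bar>)" for \<sigma> \<tau>
    proof -
      have "l \<sigma> = qform (H \<tau>) (x \<sigma>) + a * ((\<sigma> - \<tau>) * qform G (x \<sigma>))"
        unfolding x(3)[symmetric] qH by (simp add: algebra_simps)
      also have "\<dots> \<le> l \<tau> + \<bar>a\<bar> * (\<bar>\<sigma> - \<tau>\<bar> * \<bar>qform G (x \<sigma>)\<bar>)"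
        using max[OF x(1)] by (intro add_mono) (auto simp flip: abs_mult)
      also have "\<dots> \<le> l \<tau> + \<bar>a\<bar> * (C * \<bar>\<sigma> - \<tau>\<bar>)"
        using C[OF x(1)] by (simp add: mult_left_mono mult.commute[of C])
      finally show ?thesis .
    qed
    have "\<bar>l \<sigma> - l s\<bar> \<le> \<bar>a\<bar> * (C * \<bar>\<sigma> - s\<bar>)" for \<sigma>
      using le[of \<sigma> s] le[of s \<sigma>] by (simp add: abs_minus_commute abs_le_iff)
    then have lip: "\<bar>\<mu> \<sigma> - \<mu> s\<bar> \<le> C * \<bar>\<sigma> - s\<bar>" for \<sigma>
      using a by (simp add: \<mu>_def divide_le_eq mult_ac abs_divide flip: diff_divide_distrib)
    obtain f0 where "f0 \<in> vanishing_forms (det_curve F G)"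
      "grad f0 (vector [- of_real (\<mu> s), 1, of_real s]) $ 1 \<noteq> 0"
      using form[OF s x0 eig] by blast
    then obtain d where d: "(\<mu> has_real_derivative d) (at s)"
      and dual: "proj (vector [1, of_real (\<mu> s - s * d), of_real d]) \<in> dual_curve (det_curve F G)"
      using dual_curve_tangent[OF _ _ curve lip] by blast
    have ls: "a * \<mu> s = a * (qform F (x s) + s * qform G (x s))"
      using a x(3)[of s] by (simp add: \<mu>_def qH)
    \<comment> \<open>Envelope argument: with \<open>x s\<close> held fixed, the maximality of
      \<open>l\<close> gives \<open>g\<close> the minimum zero at \<open>s\<close>, so its
      derivative vanishes there.\<close>
    define g where "g \<sigma> = a * \<mu> \<sigma> - a * (qform F (x s) + \<sigma> * qform G (x s))" for \<sigma>
    have "(g has_real_derivative a * d - a * qform G (x s)) (at s)"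
      unfolding g_def by (auto intro!: derivative_eq_intros d)
    moreover have "g s \<le> g \<sigma>" for \<sigma>
      using ls max[OF x(1), of \<sigma> s] a by (simp add: g_def qH \<mu>_def)
    ultimately have "a * d - a * qform G (x s) = 0"
      using DERIV_local_min[of g _ s 1] zero_less_one by blast
    then have d_eq: "d = qform G (x s)" using a by simp
    then have "\<mu> s - s * d = qform F (x s)" using ls a by simp
    then have "(qform F (x s), qform G (x s)) \<in> boundary_generating_curve F G"
      using dual d_eq by (simp add: boundary_generating_curve_def)
    moreover have "a * fst w + a * s * snd w \<le> a * qform F (x s) + a * s * qform G (x s)"
      if "w \<in> convex_support F G" for w
      using convex_support_le[OF F G that psd[of s, unfolded H_def]] x(3)[of s]
      by (simp add: qH algebra_simps)
    ultimately show ?thesis using x(1) by blast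
  qed
  with B show ?thesis using that by blast
qed

section \<open>Density of the good directions and separation\<close>

text \<open>Moving the first coordinate off zero if necessary, and then the second off the finitely
  many values \<open>c * s\<close> with \<open>s\<close> in \<open>B\<close>, costs at most
  \<open>e / 2\<close> each.\<close>

lemma finite_slopes_nearby_direction:
  fixes a :: "real \<times> real"
  assumes "finite B" "e > 0"
  obtains c s where "c \<noteq> 0" "s \<notin> B" "dist (c, c * s) a < e"
proof -
  define c where "c = (if fst a = 0 then e / 2 else fst a)"
  have c: "c \<noteq> 0" "\<bar>c - fst a\<bar> \<le> e / 2" using assms(2) by (auto simp: c_def)
  have "infinite ({snd a<..<snd a + e / 2} - (*) c ` B)"
    using assms by (intro Diff_infinite_finite) auto
  then obtain b where b: "b \<in> {snd a<..<snd a + e / 2} - (*) c ` B"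
    using infinite_imp_nonempty by blast
  have "dist (c, b) a \<le> \<bar>c - fst a\<bar> + \<bar>b - snd a\<bar>"
    by (cases a) (simp add: dist_Pair_Pair dist_real_def sqrt_sum_squares_le_sum_abs)
  also have "\<dots> < e" using b c(2) by auto
  finally have "dist (c, c * (b / c)) a < e" using c by simp
  moreover have "b / c \<notin> B"
  proof
    assume "b / c \<in> B"
    then have "c * (b / c) \<in> (*) c ` B" by (rule imageI)
    then show False using b c(1) by simp
  qed
  ultimately show ?thesis using that c by blast
qed

text \<open>The density matrix is the rank one projection onto the line of \<open>x\<close>.\<close>

lemma qform_in_convex_support:
  fixes F G :: "complex^'n^'n"
  assumes "hermitian F" "hermitian G" "norm x = 1"
  shows "(qform F x, qform G x) \<in> convex_support F G"
proof -
  define R where "R = (\<chi> i j. x $ i * cnj (x $ j))"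
  have trace_mult: "trace (A ** R) = (\<Sum>i\<in>UNIV. cnj (x $ i) * (A *v x) $ i)" for A
    by (simp add: trace_def matrix_matrix_mult_def matrix_vector_mult_def R_def sum_distrib_left mult_ac)
  have R_mult: "(R *v y) $ i = (\<Sum>j\<in>UNIV. cnj (x $ j) * y $ j) * x $ i" for y i
    by (simp add: matrix_vector_mult_def R_def sum_distrib_left mult_ac)
  have "trace R = of_real (x \<bullet> x)"
    by (simp add: trace_def R_def inner_vec_def dot_square_norm flip: complex_norm_square)
  then have "trace R = 1" using assms(3) by (simp add: dot_square_norm)
  moreover have "pos_semidef R"
    unfolding pos_semidef_iff
  proof (intro conjI allI)
    show "hermitian R" by (simp add: hermitian_def mat_adj_def R_def vec_eq_iff mult.commute)
    fix y
    define z where "z = (\<Sum>j\<in>UNIV. cnj (x $ j) * y $ j)"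
    have "cnj z = (\<Sum>i\<in>UNIV. x $ i * cnj (y $ i))" by (simp add: z_def)
    moreover have "(\<Sum>i\<in>UNIV. cnj (y $ i) * (R *v y) $ i) = z * (\<Sum>i\<in>UNIV. x $ i * cnj (y $ i))"
      unfolding R_mult z_def[symmetric] by (simp add: sum_distrib_left mult_ac)
    ultimately have "(\<Sum>i\<in>UNIV. cnj (y $ i) * (R *v y) $ i) = z * cnj z" by simp
    then show "0 \<le> y \<bullet> (R *v y)" by (simp add: inner_vec_complex complex_mult_cnj)
  qed
  moreover have "Re (hs_inner A R) = qform A x" if "hermitian A" for A
    using that by (simp add: hs_inner_def hermitian_def trace_mult qform_def inner_vec_complex)
  ultimately show ?thesis
    using assms(1,2) unfolding convex_support_def density_matrices_def by force
qed

theorem lemma2p1: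
  fixes F1 F2 :: "complex^'d^'d"
  assumes "hermitian F1" and "hermitian F2"
  shows "convex_support F1 F2 \<subseteq> convex hull (boundary_generating_curve F1 F2)"
proof
  fix w assume w: "w \<in> convex_support F1 F2"
  define S where "S = (\<lambda>x. (qform F1 x, qform F2 x)) ` sphere 0 1"
  \<comment> \<open>\<open>S\<close> is the numerical range, which is compact. Intersecting the
    closed curve with it gives a compact set, whose convex hull is closed and can be strictly
    separated from \<open>w\<close>.\<close>
  define T where "T = S \<inter> boundary_generating_curve F1 F2"
  obtain B where B: "finite B" and support: "\<And>a s. a \<noteq> 0 \<Longrightarrow> s \<notin> B \<Longrightarrow> \<exists>x. norm x = 1 \<and>
      (qform F1 x, qform F2 x) \<in> boundary_generating_curve F1 F2 \<and>
      (\<forall>w\<in>convex_support F1 F2. a * fst w + a * s * snd w \<le> a * qform F1 x + a * s * qform F2 x)"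
    using generic_support_point[OF assms] by blast
  have "compact S"
    unfolding S_def by (intro compact_continuous_image continuous_intros qform_continuous compact_sphere)
  then have T: "compact T"
    unfolding T_def by (intro compact_Int_closed closed_boundary_generating_curve)
  have "w \<in> convex hull T"
  proof (rule ccontr)
    assume "w \<notin> convex hull T"
    then obtain a b where a: "inner a w < b" "\<And>x. x \<in> convex hull T \<Longrightarrow> inner a x > b"
      using separating_hyperplane_closed_point[OF convex_convex_hull] T
      by (metis compact_convex_hull compact_imp_closed)
    obtain R where R: "R > 0" "\<And>x. x \<in> T \<Longrightarrow> norm x \<le> R"
      using T compact_imp_bounded bounded_pos by metis
    \<comment> \<open>The separation gap divided by a bound for \<open>norm (x - w)\<close> with
      \<open>x\<close> in \<open>T\<close>: turning the direction by less than \<open>e\<close>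
      cannot close the gap.\<close>
    define e where "e = (b - inner a w) / (R + norm w)"
    have "R + norm w > 0" using R(1) by (simp add: add_pos_nonneg)
    then have "e > 0" using a(1) by (simp add: e_def)
    \<comment> \<open>The separation bounds \<open>T\<close> from below, whereas supporting points
      are maximal; hence a direction near \<open>- a\<close>.\<close>
    then obtain c s where cs: "c \<noteq> 0" "s \<notin> B" "dist (c, c * s) (- a) < e"
      using finite_slopes_nearby_direction[OF B] by blast
    define a' where "a' = (c, c * s)"
    obtain x where x: "x \<in> T" "inner a' w \<le> inner a' x"
    proof -
      obtain y where y: "norm y = 1" "(qform F1 y, qform F2 y) \<in> boundary_generating_curve F1 F2"
        "c * fst w + c * s * snd w \<le> c * qform F1 y + c * s * qform F2 y"
        using support[OF cs(1,2)] w by blast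
      show thesis
        by (rule that[of "(qform F1 y, qform F2 y)"])
          (use y in \<open>auto simp: T_def S_def a'_def inner_prod_def\<close>)
    qed
    \<comment> \<open>As \<open>x\<close> supports in the direction \<open>a'\<close>, adding
      \<open>a'\<close> to \<open>a\<close> only increases the product with \<open>x - w\<close>,
      while \<open>a' + a\<close> is shorter than \<open>e\<close>.\<close>
    have "b - inner a w < inner a x - inner a w"
      using a(2)[OF hull_inc[OF x(1)]] by simp
    also have "\<dots> \<le> inner (a' + a) (x - w)"
      using x(2) by (simp add: inner_diff_right inner_add_left)
    also have "\<dots> \<le> norm (a' + a) * norm (x - w)" by (rule norm_cauchy_schwarz)
    also have "\<dots> \<le> e * (R + norm w)"
      using cs(3) R(2)[OF x(1)] norm_triangle_ineq4[of x w] \<open>e > 0\<close>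
      by (intro mult_mono) (auto simp: a'_def dist_norm)
    also have "\<dots> = b - inner a w" using \<open>R + norm w > 0\<close> by (simp add: e_def)
    finally show False by simp
  qed
  moreover have "convex hull T \<subseteq> convex hull (boundary_generating_curve F1 F2)"
    by (intro hull_mono) (simp add: T_def)
  ultimately show "w \<in> convex hull (boundary_generating_curve F1 F2)" by blast
qed

end
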